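(* Let $m\ge3$ be odd. The binary code $P=\phi(\mathcal P)$ of length $N=2^{m+1}$ is completely regular.
   Context: Let $n=2^m-1$, $h_2(X)\in\mathbb Z_2[X]$ primitive irreducible of degree $m$, $h(X)\in\mathbb Z_4[X]$ the unique monic degree-$m$ polynomial with $h\equiv h_2\pmod 2$ and $h\mid X^n-1$ in $\mathbb Z_4[X]$. $\mathcal P$ is obtained from the cyclic code of length $n$ over $\mathbb Z_4$ generated by $h(X)$ (ideal of $\mathbb Z_4[X]/(X^n-1)$) by adjoining a zero-sum check coordinate $c_\infty=-\sum c_t$. Gray map: $\beta(0,1,2,3)=(0,0,1,1)$, $\gamma(0,1,2,3)=(0,1,1,0)$ componentwise, $\phi(c)=(\beta(c),\gamma(c))$. For a binary code $C$ of length $N$, its outer distribution matrix $B$ is the $2^N\times(N+1)$ matrix with entries $B_{x,j}=|\{y\in C:d(x,y)=j\}|$ for $x\in\mathbb Z_2^N$, $0\le j\le N$ ($d$ = Hamming distance). $C$ with covering radius $r$ is completely regular if $B$ has exactly $r+1$ distinct rows. *)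

theory Defs
  imports
    "HOL-Library.Numeral_Type"
    "HOL-Library.Z2"
    "HOL-Computational_Algebra.Polynomial"
begin

section \<open>Binary codes, outer distribution and complete regularity\<close>

text \<open>Binary words of length \<open>N\<close> are lists over the two-element field \<^typ>\<open>bit\<close>.\<close>

definition words :: "nat \<Rightarrow> bit list set" where
  "words N = {x. length x = N}"

text \<open>Only meaningful for lists of equal length.\<close>

definition hamming_dist :: "bit list \<Rightarrow> bit list \<Rightarrow> nat" where
  "hamming_dist x y = card {i. i < length x \<and> x ! i \<noteq> y ! i}"

definition covering_radius :: "nat \<Rightarrow> bit list set \<Rightarrow> nat" where
  "covering_radius N C = Max ((\<lambda>x. Min (hamming_dist x ` C)) ` words N)"

definition outer_distribution :: "bit list set \<Rightarrow> bit list \<Rightarrow> nat \<Rightarrow> nat" where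
  "outer_distribution C x j = card {y \<in> C. hamming_dist x y = j}"

definition outer_row :: "nat \<Rightarrow> bit list set \<Rightarrow> bit list \<Rightarrow> nat list" where
  "outer_row N C x = map (outer_distribution C x) [0..<Suc N]"

text \<open>The first two conjuncts say that \<open>C\<close> is a (nonempty) binary code of length \<open>N\<close>; they
  also ensure that the \<open>Min\<close> and \<open>Max\<close> in the covering radius are those of finite nonempty sets.\<close>

definition completely_regular :: "nat \<Rightarrow> bit list set \<Rightarrow> bool" where
  "completely_regular N C \<longleftrightarrow>
     C \<subseteq> words N \<and> C \<noteq> {} \<and>
     card (outer_row N C ` words N) = covering_radius N C + 1"


section \<open>The Gray map\<close>

text \<open>The ring of integers modulo 4 is the numeral type \<^typ>\<open>4\<close>.\<close>

definition gray_beta :: "4 \<Rightarrow> bit" where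
  "gray_beta c = (if c = 2 \<or> c = 3 then 1 else 0)"

definition gray_gamma :: "4 \<Rightarrow> bit" where
  "gray_gamma c = (if c = 1 \<or> c = 2 then 1 else 0)"

definition gray :: "4 list \<Rightarrow> bit list" where
  "gray c = map gray_beta c @ map gray_gamma c"


section \<open>The quaternary code\<close>

text \<open>The order condition says that the class of \<open>X\<close> has multiplicative order
  \<open>2 ^ degree p - 1\<close> in the field \<open>\<int>\<^sub>2[X]/(p)\<close>, i.e. that it generates the multiplicative group.\<close>

definition primitive_irreducible :: "bit poly \<Rightarrow> bool" where
  "primitive_irreducible p \<longleftrightarrow>
     irreducible p \<and>
     p dvd monom 1 (2 ^ degree p - 1) - 1 \<and>
     (\<forall>e. 0 < e \<and> e < 2 ^ degree p - 1 \<longrightarrow> \<not> p dvd monom 1 e - 1)"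

definition reduce2 :: "4 \<Rightarrow> bit" where
  "reduce2 c = (if c = 1 \<or> c = 3 then 1 else 0)"

text \<open>For a primitive irreducible \<open>p\<close> of degree \<open>m\<close> and \<open>n = 2 ^ m - 1\<close> there is exactly one
  such \<open>h\<close>.\<close>

definition is_lift :: "nat \<Rightarrow> bit poly \<Rightarrow> 4 poly \<Rightarrow> bool" where
  "is_lift n p h \<longleftrightarrow>
     lead_coeff h = 1 \<and> degree h = degree p \<and>
     map_poly reduce2 h = p \<and>
     h dvd monom 1 n - 1"

text \<open>The word \<open>[c\<^sub>0, \<dots>, c\<^bsub>n-1\<^esub>]\<close> stands for the residue class of
  \<open>c\<^sub>0 + \<dots> + c\<^bsub>n-1\<^esub> X\<^bsup>n-1\<^esup>\<close> modulo \<open>X\<^bsup>n\<^esup> - 1\<close>; it is in the code iff this class lies in the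
  ideal generated by the class of \<open>h\<close>.\<close>

definition cyclic_code :: "nat \<Rightarrow> 4 poly \<Rightarrow> 4 list set" where
  "cyclic_code n h = {c. length c = n \<and> (\<exists>a. monom 1 n - 1 dvd Poly c - a * h)}"

text \<open>The check coordinate \<open>c\<^sub>\<infinity>\<close> is placed in front.\<close>

definition adjoin_check :: "4 list \<Rightarrow> 4 list" where
  "adjoin_check c = (- sum_list c) # c"

definition preparata_Z4 :: "nat \<Rightarrow> 4 poly \<Rightarrow> 4 list set" where
  "preparata_Z4 n h = adjoin_check ` cyclic_code n h"

end

theory Submission
  imports Defs Complex_Main "HOL-Computational_Algebra.Polynomial_Factorial"
begin

text \<open>
  The Gray map is an isometry for the Lee metric, so everything happens for the quaternary code.
  Put \<open>q = 2\<^sup>m\<close> and \<open>a = 2\<^bsup>(m-1)/2\<^esup>\<close>, so that \<open>q = 2 a\<^sup>2\<close>. Poisson summation expresses the Lee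
  enumerator of a translate of the code through the Lee weights of the dual words
  \<open>\<epsilon> + \<lambda>(x)\<close>, where \<open>x\<close> runs through the Teichmueller set \<open>{0, 1, \<xi>, \<xi>\<^sup>2, \<dots>}\<close> of \<open>\<int>\<^sub>4[X]/(h)\<close> and
  \<open>\<lambda>\<close> through the linear functionals. The exponential sum \<open>S(\<lambda>) = \<Sum>\<^sub>x i\<^bsup>\<lambda>(x)\<^esup>\<close> of an odd functional
  has norm \<open>q\<close>, because squares of arbitrary ring elements lie in the Teichmueller set; as \<open>m\<close> is odd,
  its real and imaginary parts are \<open>\<plusminus>a\<close>. So only the weights \<open>0\<close>, \<open>q - a\<close>, \<open>q\<close>, \<open>q + a\<close>, \<open>2q\<close> occur,
  and they pair up under \<open>\<epsilon> \<mapsto> \<epsilon> + 2\<close>. Hence the row of a word is determined by its parity and the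
  numbers \<open>B\<^sub>0, B\<^sub>1, B\<^sub>2\<close> of codewords at distance at most 2. For a codeword the same formula gives
  \<open>B\<^sub>2 = B\<^sub>4 = 0\<close>, so the minimum distance is at least 6, whence \<open>B\<^sub>j \<le> 1\<close> for \<open>j \<le> 2\<close>. Therefore the
  row depends only on the distance to the code, and these distances are exactly \<open>0, \<dots>, r\<close>.
\<close>

section \<open>Words over the integers modulo 4 and the Gray map\<close>

lemma UNIV_4: "(UNIV :: 4 set) = {0, 1, 2, 3}"
proof -
  have "x = 0 \<or> x = 1 \<or> x = 2 \<or> x = 3" for x :: 4
  proof (cases x)
    case (of_int z)
    then have "z = 0 \<or> z = 1 \<or> z = 2 \<or> z = 3" by auto
    with of_int show ?thesis by auto
  qed
  then show ?thesis by auto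
qed

lemma all_4: "(\<forall>x :: 4. P x) \<longleftrightarrow> P 0 \<and> P 1 \<and> P 2 \<and> P 3"
  by (metis UNIV_4 UNIV_I empty_iff insert_iff)

lemma sum_4: "(\<Sum>x\<in>(UNIV :: 4 set). f x) = f 0 + f 1 + f 2 + f 3"
  unfolding UNIV_4 by (simp add: add.assoc)

text \<open>The additive character x \<mapsto> \<i>^x of Z_4.\<close>

definition chi :: "4 \<Rightarrow> complex" where
  "chi x = (if x = 0 then 1 else if x = 1 then \<i> else if x = 2 then -1 else -\<i>)"

definition lee :: "4 \<Rightarrow> nat" where
  "lee x = (if x = 0 then 0 else if x = 2 then 2 else 1)"

lemma chi_0 [simp]: "chi 0 = 1"
  by (simp add: chi_def)

lemma chi_add: "chi (x + y) = chi x * chi y"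
proof -
  have "\<forall>x y. chi (x + y) = chi x * chi y"
    by (simp add: all_4 chi_def)
  then show ?thesis by blast
qed

lemma chi_sum: "chi (sum f A) = (\<Prod>x\<in>A. chi (f x))"
  by (induction A rule: infinite_finite_induct) (auto simp: chi_add)

lemma cnj_chi: "cnj (chi x) = chi (- x)"
proof -
  have "\<forall>x. cnj (chi x) = chi (- x)"
    by (simp add: all_4 chi_def)
  then show ?thesis by blast
qed

lemma sum_chi_mult: "(\<Sum>a\<in>UNIV. chi (a * b)) = (if b = 0 then 4 else 0)"
proof -
  have "\<forall>b. (\<Sum>a\<in>UNIV. chi (a * b)) = (if b = 0 then 4 else 0)"
    by (simp add: all_4 sum_4 chi_def)
  then show ?thesis by blast
qed

text \<open>The units 1 and 3 are the elements of odd Lee weight, so the parity of the Lee weight is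
  itself an additive character.\<close>

lemma minus_one_power_lee: "(-1) ^ lee x = chi (2 * x)"
proof -
  have "\<forall>x. (-1) ^ lee x = chi (2 * x)"
    by (simp add: all_4 lee_def chi_def)
  then show ?thesis by blast
qed

text \<open>The values 0, 1, 2, 3 go to 00, 01, 11, 10, consecutive corners of a square, and both
  sides measure the distance along this cycle. This is the isometry in one coordinate.\<close>

lemma lee_diff_gray:
  "lee (a - b) = of_bool (gray_beta a \<noteq> gray_beta b) + of_bool (gray_gamma a \<noteq> gray_gamma b)"
proof -
  have "\<forall>a b. lee (a - b) = of_bool (gray_beta a \<noteq> gray_beta b) + of_bool (gray_gamma a \<noteq> gray_gamma b)"
    by (simp add: all_4 lee_def gray_beta_def gray_gamma_def)
  then show ?thesis by blast
qed

lemma hamming_dist_eq_sum: "hamming_dist x y = (\<Sum>i<length x. of_bool (x ! i \<noteq> y ! i))"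
proof -
  have "{i. i < length x \<and> x ! i \<noteq> y ! i} = {..<length x} \<inter> {i. x ! i \<noteq> y ! i}" by auto
  then show ?thesis by (simp add: hamming_dist_def)
qed

lemma hamming_dist_gray:
  assumes "length u = q" "length v = q"
  shows "hamming_dist (gray u) (gray v) = (\<Sum>j<q. lee (u ! j - v ! j))"
proof -
  let ?f = "\<lambda>i. of_bool (gray u ! i \<noteq> gray v ! i) :: nat"
  have "hamming_dist (gray u) (gray v) = (\<Sum>i<q + q. ?f i)"
    using assms by (simp add: hamming_dist_eq_sum gray_def)
  \<comment> \<open>\<open>gray\<close> lists all beta bits first, so position \<open>j + q\<close>
    holds the gamma bit of coordinate \<open>j\<close>.\<close>
  also have "\<dots> = (\<Sum>i<q. ?f i) + (\<Sum>i = q..<q + q. ?f i)"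
    by (simp only: lessThan_atLeast0) (rule sum.atLeastLessThan_concat[symmetric], auto)
  also have "(\<Sum>i = q..<q + q. ?f i) = (\<Sum>i<q. ?f (i + q))"
    using sum.shift_bounds_nat_ivl[of ?f 0 q q] by (simp add: lessThan_atLeast0)
  also have "(\<Sum>i<q. ?f i) = (\<Sum>j<q. of_bool (gray_beta (u ! j) \<noteq> gray_beta (v ! j)))"
    using assms by (intro sum.cong) (auto simp: gray_def nth_append)
  also have "(\<Sum>i<q. ?f (i + q)) = (\<Sum>j<q. of_bool (gray_gamma (u ! j) \<noteq> gray_gamma (v ! j)))"
    using assms by (intro sum.cong) (auto simp: gray_def nth_append)
  finally show ?thesis by (simp only: lee_diff_gray sum.distrib)
qed

text \<open>An isometry is injective: equal images are at distance 0, and only 0 has Lee weight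
  0.\<close>

lemma inj_gray:
  assumes "length u = length v" "gray u = gray v"
  shows "u = v"
proof (rule nth_equalityI)
  show "length u = length v" by (rule assms)
  fix i assume i: "i < length u"
  have "(\<Sum>j<length u. lee (u ! j - v ! j)) = hamming_dist (gray u) (gray v)"
    by (rule hamming_dist_gray[symmetric]) (simp_all only: assms(1))
  also have "\<dots> = 0" by (simp add: hamming_dist_def assms(2))
  finally have "\<forall>j\<in>{..<length u}. lee (u ! j - v ! j) = 0"
    by (simp only: sum_eq_0_iff finite_lessThan)
  with i have "lee (u ! i - v ! i) = 0" by blast
  then have "u ! i - v ! i = 0" by (simp only: lee_def split: if_splits)
  then show "u ! i = v ! i" by simp
qed

lemma gray_surj:
  assumes x: "length x = 2 * q"
  obtains c where "length c = q" "gray c = x"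
proof
  \<comment> \<open>The inverse in one coordinate: 00, 01, 11, 10 come from 0, 1, 2, 3.\<close>
  define g :: "bit \<Rightarrow> bit \<Rightarrow> 4" where
    "g = (\<lambda>a b. if a = 0 then if b = 0 then 0 else 1 else if b = 1 then 2 else 3)"
  have g1: "gray_beta (g a b) = a" for a b
    by (cases "a = 0"; cases "b = 0") (simp_all add: g_def gray_beta_def)
  have g2: "gray_gamma (g a b) = b" for a b
    by (cases "a = 0"; cases "b = 0") (simp_all add: g_def gray_gamma_def)
  let ?c = "map2 g (take q x) (drop q x)"
  show "length ?c = q" using x by simp
  have "map gray_beta ?c = take q x"
    using x by (intro nth_equalityI) (simp_all add: g1)
  moreover have "map gray_gamma ?c = drop q x"
    using x by (intro nth_equalityI) (simp_all add: g2)
  ultimately show "gray ?c = x"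
    unfolding gray_def by (simp only: append_take_drop_id)
qed

text \<open>Expanding a product of sums chooses one summand per factor. This serves coefficient
  lists of length \<open>m\<close> as well as words of length \<open>q\<close>.\<close>

lemma sum_prod_lists:
  fixes F :: "nat \<Rightarrow> 'a::finite \<Rightarrow> 'b::comm_semiring_1"
  shows "(\<Sum>c | length c = n. \<Prod>j<n. F j (c ! j)) = (\<Prod>j<n. \<Sum>a\<in>UNIV. F j a)"
proof (induction n arbitrary: F)
  case (Suc n)
  have eq: "{c :: 'a list. length c = Suc n} = (\<lambda>(a, c). a # c) ` (UNIV \<times> {c. length c = n})"
    by (auto simp: length_Suc_conv image_iff)
  have "(\<Sum>c | length c = Suc n. \<Prod>j<Suc n. F j (c ! j))
      = (\<Sum>(a, c)\<in>UNIV \<times> {c. length c = n}. F 0 a * (\<Prod>j<n. F (Suc j) (c ! j)))"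
    unfolding eq by (subst sum.reindex) (auto simp: inj_on_def prod.lessThan_Suc_shift case_prod_beta simp del: prod.lessThan_Suc intro!: sum.cong)
  also have "\<dots> = (\<Sum>a\<in>UNIV. F 0 a) * (\<Sum>c | length c = n. \<Prod>j<n. F (Suc j) (c ! j))"
    by (simp add: sum_product sum.cartesian_product)
  also have "\<dots> = (\<Prod>j<Suc n. \<Sum>a\<in>UNIV. F j a)"
    by (subst Suc) (simp add: prod.lessThan_Suc_shift del: prod.lessThan_Suc)
  finally show ?case .
qed auto

section \<open>Hamming distance\<close>

lemma hamming_dist_commute: "length x = length y \<Longrightarrow> hamming_dist x y = hamming_dist y x"
  by (simp add: hamming_dist_def eq_commute)

lemma hamming_dist_triangle:
  assumes "length x = length y" "length y = length z"
  shows "hamming_dist x z \<le> hamming_dist x y + hamming_dist y z"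
proof -
  have "hamming_dist x z \<le> card ({i. i < length x \<and> x ! i \<noteq> y ! i} \<union> {i. i < length y \<and> y ! i \<noteq> z ! i})"
    unfolding hamming_dist_def using assms by (intro card_mono) auto
  also have "\<dots> \<le> hamming_dist x y + hamming_dist y z"
    unfolding hamming_dist_def by (rule card_Un_le)
  finally show ?thesis .
qed

lemma hamming_dist_le: "hamming_dist x y \<le> length x"
proof -
  have "hamming_dist x y \<le> card {..<length x}"
    unfolding hamming_dist_def by (intro card_mono) auto
  then show ?thesis by simp
qed

text \<open>Flip one position in which the words differ. Such steps show that no distance to a code
  is skipped below the largest one.\<close>

lemma hamming_dist_step:
  assumes "length x = length y" "hamming_dist x y = Suc k"
  obtains x' where "length x' = length x" "hamming_dist x x' = 1" "hamming_dist x' y = k"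
proof -
  let ?D = "{i. i < length x \<and> x ! i \<noteq> y ! i}"
  have "card ?D = Suc k" using assms(2) by (simp add: hamming_dist_def)
  then obtain i where i: "i \<in> ?D" by (metis card_eq_0_iff ex_in_conv nat.distinct(1))
  let ?x = "x[i := y ! i]"
  have "{j. j < length ?x \<and> ?x ! j \<noteq> y ! j} = ?D - {i}"
    using i by (auto simp: nth_list_update)
  with i \<open>card ?D = Suc k\<close> have "hamming_dist ?x y = k"
    by (simp add: hamming_dist_def)
  moreover have "{j. j < length x \<and> x ! j \<noteq> ?x ! j} = {i}"
    using i by (auto simp: nth_list_update)
  then have "hamming_dist x ?x = 1" by (simp add: hamming_dist_def)
  ultimately show ?thesis using that[of ?x] by simp
qed

lemma finite_words: "finite (words N)"
proof -
  have "(UNIV :: bit set) = {0, 1}" by auto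
  then have "finite (UNIV :: bit set)" by (metis finite.emptyI finite_insert)
  from finite_lists_length_eq[OF this, of N] show ?thesis by (simp add: words_def)
qed

section \<open>A criterion for complete regularity\<close>

lemma downward_closed_card:
  assumes "finite S" "S \<noteq> {}" "\<And>k. Suc k \<in> S \<Longrightarrow> k \<in> S"
  shows "card S = Max S + (1 :: nat)"
proof -
  have *: "k \<in> S" if "k \<le> Max S" for k
    using that
  proof (induction rule: inc_induct)
    case base then show ?case using assms(1,2) by (rule Max_in)
  next
    case (step n) then show ?case using assms(3) by blast
  qed
  have "S = {..Max S}"
    using * Max_ge[OF assms(1)] by blast
  then have "card S = card {..Max S}" by (rule arg_cong)
  then show ?thesis by simp
qed

abbreviation dist_to :: "bit list set \<Rightarrow> bit list \<Rightarrow> nat" where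
  "dist_to C x \<equiv> Min (hamming_dist x ` C)"

text \<open>The row always determines the distance to the code, as its first nonzero position. If
  conversely the distance determines the row, the distinct rows are counted by the distances, and
  these fill an initial segment of the natural numbers.\<close>

lemma completely_regularI:
  assumes C: "C \<subseteq> words N" "C \<noteq> {}"
    and row: "\<And>x y. x \<in> words N \<Longrightarrow> y \<in> words N \<Longrightarrow> dist_to C x = dist_to C y \<Longrightarrow> outer_row N C x = outer_row N C y"
  shows "completely_regular N C"
proof -
  have fin: "finite C" using C finite_words finite_subset by blast
  have ex: "\<exists>y\<in>C. hamming_dist x y = dist_to C x" for x
  proof -
    have "dist_to C x \<in> hamming_dist x ` C" using fin C(2) by (intro Min_in) auto
    then show ?thesis by force
  qed
  have le: "dist_to C x \<le> hamming_dist x y" if "y \<in> C" for x y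
    using fin that by simp
  have outer: "dist_to C x = (LEAST j. outer_row N C x ! j \<noteq> 0)" if x: "x \<in> words N" for x
  proof (rule Least_equality[symmetric])
    obtain y where y: "y \<in> C" "hamming_dist x y = dist_to C x" using ex by blast
    \<comment> \<open>Rows have length \<open>N + 1\<close>, so this index is in range.\<close>
    have "dist_to C x \<le> N" using y hamming_dist_le[of x y] x by (simp add: words_def)
    then have "outer_row N C x ! dist_to C x = card {y \<in> C. hamming_dist x y = dist_to C x}"
      by (simp add: outer_row_def outer_distribution_def del: upt_Suc)
    moreover have "\<dots> \<noteq> 0" using y fin by auto
    ultimately show "outer_row N C x ! dist_to C x \<noteq> 0" by simp
    fix j assume j: "outer_row N C x ! j \<noteq> 0"
    show "dist_to C x \<le> j"
    proof (rule ccontr)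
      assume "\<not> ?thesis"
      then have lt: "j < dist_to C x" by simp
      with \<open>dist_to C x \<le> N\<close> have "outer_row N C x ! j = card {y \<in> C. hamming_dist x y = j}"
        by (simp add: outer_row_def outer_distribution_def del: upt_Suc)
      also have "{y \<in> C. hamming_dist x y = j} = {}" using le[of _ x] lt by fastforce
      finally show False using j by simp
    qed
  qed
  have "bij_betw (\<lambda>r. LEAST j. r ! j \<noteq> 0) (outer_row N C ` words N) (dist_to C ` words N)"
    unfolding bij_betw_def
  proof
    show "inj_on (\<lambda>r. LEAST j. r ! j \<noteq> 0) (outer_row N C ` words N)"
    proof (rule inj_onI, clarify)
      fix x y assume xy: "x \<in> words N" "y \<in> words N"
        and "(LEAST j. outer_row N C x ! j \<noteq> 0) = (LEAST j. outer_row N C y ! j \<noteq> 0)"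
      then have "dist_to C x = dist_to C y" by (simp only: outer)
      then show "outer_row N C x = outer_row N C y" using xy row by blast
    qed
    show "(\<lambda>r. LEAST j. r ! j \<noteq> 0) ` outer_row N C ` words N = dist_to C ` words N"
      unfolding image_image by (rule image_cong) (simp_all only: outer)
  qed
  then have "card (outer_row N C ` words N) = card (dist_to C ` words N)"
    by (rule bij_betw_same_card)
  also have "\<dots> = Max (dist_to C ` words N) + 1"
  proof (rule downward_closed_card)
    show "finite (dist_to C ` words N)" using finite_words by simp
    show "dist_to C ` words N \<noteq> {}" using C by auto
    \<comment> \<open>One flip towards a nearest codeword lowers the distance by exactly one: a
      larger drop would, by the triangle inequality, bring \<open>x\<close> itself closer to the
      code.\<close>
    fix k assume "Suc k \<in> dist_to C ` words N"
    then obtain x where x: "x \<in> words N" "dist_to C x = Suc k" by auto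
    obtain y where y: "y \<in> C" "hamming_dist x y = Suc k" using ex[of x] x by auto
    have ly: "length x = length y" using C x y by (auto simp: words_def)
    obtain x' where x': "length x' = length x" "hamming_dist x x' = 1" "hamming_dist x' y = k"
      using hamming_dist_step[OF ly y(2)] by blast
    have "dist_to C x' \<le> k" using le[OF y(1), of x'] x' by simp
    moreover obtain y' where y': "y' \<in> C" "hamming_dist x' y' = dist_to C x'" using ex by blast
    moreover have "Suc k \<le> hamming_dist x y'" using le[OF y'(1), of x] x by simp
    moreover have "hamming_dist x y' \<le> hamming_dist x x' + hamming_dist x' y'"
      using x' y' x C by (intro hamming_dist_triangle) (auto simp: words_def)
    ultimately have "dist_to C x' = k" using x' by linarith
    moreover have "x' \<in> words N" using x x' by (simp add: words_def)
    ultimately show "k \<in> dist_to C ` words N" by blast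
  qed
  finally show ?thesis using C by (simp add: completely_regular_def covering_radius_def)
qed

section \<open>The Teichmueller set\<close>

lemma reduce2_add: "reduce2 (x + y) = reduce2 x + reduce2 y"
proof -
  have "\<forall>x y. reduce2 (x + y) = reduce2 x + reduce2 y"
    by (simp add: all_4 reduce2_def)
  then show ?thesis by blast
qed

lemma reduce2_mult: "reduce2 (x * y) = reduce2 x * reduce2 y"
proof -
  have "\<forall>x y. reduce2 (x * y) = reduce2 x * reduce2 y"
    by (simp add: all_4 reduce2_def)
  then show ?thesis by blast
qed

lemma reduce2_0 [simp]: "reduce2 0 = 0"
  by (simp add: reduce2_def)

lemma reduce2_sum: "reduce2 (sum f A) = (\<Sum>x\<in>A. reduce2 (f x))"
  by (induction A rule: infinite_finite_induct) (auto simp: reduce2_add)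

abbreviation red :: "4 poly \<Rightarrow> bit poly" where
  "red \<equiv> map_poly reduce2"

lemma red_add: "red (p + r) = red p + red r"
  by (rule poly_eqI) (simp add: coeff_map_poly reduce2_add)

lemma red_mult: "red (p * r) = red p * red r"
  by (rule poly_eqI) (simp add: coeff_map_poly coeff_mult reduce2_sum reduce2_mult)

lemma red_monom: "red (monom 1 k) = monom 1 k"
  by (simp add: map_poly_monom reduce2_def)

lemma red_diff: "red (p - r) = red p - red r"
  using red_add[of "p - r" r] by simp

lemma red_surj: "\<exists>p. red p = g"
proof
  show "red (map_poly (\<lambda>x. if x = 0 then 0 else 1) g) = g"
    by (rule poly_eqI) (simp add: coeff_map_poly reduce2_def)
qed

text \<open>Coefficients that reduce to 0 are 0 or 2, and these can be halved: the kernel of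
  reduction is generated by 2.\<close>

lemma red_eq_0:
  assumes "red p = 0"
  obtains b where "p = 2 * b"
proof
  have half: "reduce2 x = 0 \<Longrightarrow> x = 2 * (if x = 2 then 1 else 0)" for x
  proof -
    have "\<forall>x. reduce2 x = 0 \<longrightarrow> x = 2 * (if x = 2 then 1 else 0)"
      by (simp add: all_4 reduce2_def)
    then show "reduce2 x = 0 \<Longrightarrow> x = 2 * (if x = 2 then 1 else 0)" by blast
  qed
  have "reduce2 (coeff p k) = 0" for k
    using assms by (metis coeff_0 coeff_map_poly reduce2_0)
  then have *: "coeff p k = 2 * (if coeff p k = 2 then 1 else 0)" for k by (rule half)
  show "p = 2 * map_poly (\<lambda>x. if x = 2 then 1 else 0) p"
  proof (rule poly_eqI)
    fix k
    show "coeff p k = coeff (2 * map_poly (\<lambda>x. if x = 2 then 1 else 0) p) k"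
      using *[of k] by (simp add: numeral_poly coeff_map_poly)
  qed
qed

text \<open>As \<open>h\<close> is monic, leading terms can be cancelled without inverting a
  coefficient, so Euclidean division survives the zero divisors of Z_4.\<close>

lemma monic_division:
  fixes p h :: "'a::comm_ring_1 poly"
  assumes "lead_coeff h = 1" "degree h > 0"
  shows "\<exists>r. degree r < degree h \<and> h dvd p - r"
proof (induction "degree p" arbitrary: p rule: less_induct)
  case less
  show ?case
  proof (cases "degree p < degree h")
    case True
    then show ?thesis by (intro exI[of _ p]) simp
  next
    case False
    define d where "d = degree p - degree h"
    define p' where "p' = p - monom (lead_coeff p) d * h"
    have deg: "degree (monom (lead_coeff p) d * h) \<le> degree p"
      using degree_mult_le[of "monom (lead_coeff p) d" h] degree_monom_le[of "lead_coeff p" d] False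
      by (simp add: d_def)
    have "coeff p' (degree p) = 0"
      using False assms by (simp add: p'_def coeff_monom_mult d_def)
    moreover have "degree p' \<le> degree p"
      unfolding p'_def using deg by (intro degree_diff_le) auto
    ultimately have "degree p' < degree p"
      using False assms(2) by (metis degree_0 eq_zero_or_degree_less gr_zeroI linorder_not_le)
    from less[OF this] obtain r where r: "degree r < degree h" "h dvd p' - r" by blast
    have "p - r = (p' - r) + monom (lead_coeff p) d * h" by (simp add: p'_def)
    then have "h dvd p - r" using r(2) by (metis dvd_add dvd_triv_right)
    with r(1) show ?thesis by blast
  qed
qed

text \<open>Multiplication by a monic polynomial preserves the leading coefficient even in the
  presence of zero divisors, so degrees add. This makes remainders unique.\<close>

lemma monic_dvd_small:
  fixes p h :: "'a::comm_ring_1 poly"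
  assumes "lead_coeff h = 1" "degree p < degree h" "h dvd p"
  shows "p = 0"
proof (rule ccontr)
  assume "p \<noteq> 0"
  obtain s where s: "p = h * s" using assms(3) by blast
  with \<open>p \<noteq> 0\<close> have "s \<noteq> 0" by auto
  then have "coeff p (degree h + degree s) \<noteq> 0"
    using assms(1) by (simp add: s coeff_mult_degree_sum)
  then show False using assms(2) le_degree by fastforce
qed

lemma sum_reindex_lessThan:
  fixes q :: nat
  assumes "\<And>j. j < q \<Longrightarrow> g j < q" "inj_on g {..<q}"
  shows "(\<Sum>j<q. F (g j)) = (\<Sum>j<q. F j)"
proof -
  have "g ` {..<q} = {..<q}" by (rule endo_inj_surj) (use assms in auto)
  then have "bij_betw g {..<q} {..<q}" using assms(2) by (simp add: bij_betw_def)
  then show ?thesis by (rule sum.reindex_bij_betw)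
qed

lemma four_poly_eq_0: "(4 :: 4 poly) = 0"
  by (simp add: numeral_poly)

locale teichmueller =
  fixes m :: nat and h2 :: "bit poly" and h :: "4 poly"
  assumes odd_m: "odd m"
    and primitive: "primitive_irreducible h2" and degree_h2: "degree h2 = m"
    and lift: "is_lift (2 ^ m - 1) h2 h"
begin

section \<open>Powers of X modulo \<open>h2\<close>\<close>

definition n :: nat where "n = 2 ^ m - 1"
definition q :: nat where "q = 2 ^ m"

lemma m_pos: "m > 0" using odd_m by (rule odd_pos)

lemma q_eq: "q = Suc n" by (simp add: q_def n_def)

lemma n_pos: "n > 0"
proof -
  have "2 ^ 1 \<le> (2 :: nat) ^ m" using m_pos by (intro power_increasing) auto
  then show ?thesis by (simp add: n_def)
qed

lemma monic_h: "lead_coeff h = 1" and degree_h: "degree h = m" and red_h: "red h = h2"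
  and h_dvd: "h dvd monom 1 n - 1"
  using lift degree_h2 by (auto simp: is_lift_def n_def)

lemma h2_dvd: "h2 dvd monom 1 n - 1"
  and h2_order: "0 < e \<Longrightarrow> e < n \<Longrightarrow> \<not> h2 dvd monom 1 e - 1"
  and irreducible_h2: "irreducible h2"
  using primitive degree_h2 by (auto simp: primitive_irreducible_def n_def)

lemma prime_h2: "prime_elem h2"
  using irreducible_h2 by (simp add: field_poly_irreducible_imp_prime)

text \<open>X is invertible modulo \<open>h2\<close>, because \<open>X^n\<close> is congruent to
  1.\<close>

lemma not_h2_dvd_monom: "\<not> h2 dvd monom 1 t"
proof
  assume "h2 dvd monom 1 t"
  then have "h2 dvd monom 1 1 ^ t" by (simp add: monom_power)
  then have "h2 dvd monom 1 1" using prime_h2 prime_elem_dvd_power by blast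
  then have "h2 dvd monom 1 1 ^ n" using n_pos by (simp add: dvd_power dvd_trans)
  then have "h2 dvd monom 1 n" by (simp add: monom_power)
  then have "h2 dvd 1" using h2_dvd by (metis diff_diff_eq2 add_diff_cancel_left' dvd_diff)
  then show False using prime_h2 by (simp add: prime_elem_def)
qed

text \<open>Cancelling the smaller power leaves a power of X congruent to 1 whose positive exponent
  is below the order \<open>n\<close>.\<close>

lemma monom_inj:
  assumes "s < n" "t < n" "h2 dvd monom 1 t - monom 1 s"
  shows "s = t"
proof -
  have *: False if "s < t" "t < n" "h2 dvd monom 1 t - monom 1 s" for s t
  proof -
    have "monom 1 t - monom 1 s = monom 1 s * (monom 1 (t - s) - (1 :: bit poly))"
      using that by (simp add: algebra_simps mult_monom)
    then have "h2 dvd monom 1 s \<or> h2 dvd monom 1 (t - s) - 1"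
      using that prime_elem_dvd_multD[OF prime_h2] by metis
    then show False using not_h2_dvd_monom h2_order[of "t - s"] that by auto
  qed
  show ?thesis
  proof (rule linorder_cases)
    assume "t < s" then show ?thesis
      using *[of t s] assms dvd_minus_iff[of h2 "monom 1 t - monom 1 s"] by (auto simp del: dvd_minus_iff)
  qed (use *[of s t] assms in auto)
qed

text \<open>Index 0 is the check coordinate, index \<open>t + 1\<close> the coordinate \<open>c\<^sub>t\<close>.\<close>

definition tau :: "nat \<Rightarrow> 4 poly" where
  "tau j = (if j = 0 then 0 else monom 1 (j - 1))"

text \<open>Equality in the residue field Z_2[X]/(h2) of the Galois ring Z_4[X]/(h).\<close>

definition eqv2 :: "4 poly \<Rightarrow> 4 poly \<Rightarrow> bool" where
  "eqv2 p r \<longleftrightarrow> h2 dvd red p - red r"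

lemma eqv2_refl: "eqv2 p p" by (simp add: eqv2_def)

lemma eqv2_sym: "eqv2 p r \<Longrightarrow> eqv2 r p"
  unfolding eqv2_def by (simp only: dvd_diff_commute)

lemma eqv2_trans:
  assumes "eqv2 p r" "eqv2 r s"
  shows "eqv2 p s"
proof -
  have "h2 dvd (red p - red r) + (red r - red s)"
    using assms unfolding eqv2_def by (rule dvd_add)
  then show ?thesis by (simp add: eqv2_def)
qed

lemma eqv2_if_dvd: "h dvd p - r \<Longrightarrow> eqv2 p r"
  unfolding eqv2_def by (metis red_diff red_mult red_h dvd_def)

lemma tau_inj: "j < q \<Longrightarrow> k < q \<Longrightarrow> eqv2 (tau j) (tau k) \<Longrightarrow> j = k"
proof -
  assume jk: "j < q" "k < q" and eqv: "eqv2 (tau j) (tau k)"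
  show "j = k"
  proof (cases "j = 0 \<or> k = 0")
    case True
    with eqv not_h2_dvd_monom show ?thesis
      by (auto simp: eqv2_def tau_def red_monom split: if_splits)
  next
    case False
    with jk have "j - 1 < n" "k - 1 < n" by (auto simp: q_eq)
    moreover have "h2 dvd monom 1 (j - 1) - monom 1 (k - 1)"
      using eqv False by (simp add: eqv2_def tau_def red_monom)
    ultimately have "k - 1 = j - 1" by (intro monom_inj)
    with False show ?thesis by arith
  qed
qed

lemma small_polys: "finite {r :: bit poly. degree r < m}" "card {r :: bit poly. degree r < m} \<le> q"
proof -
  have UNIV: "(UNIV :: bit set) = {0, 1}" by auto
  have fin: "finite {xs :: bit list. length xs = m}"
    using finite_words[of m] by (simp only: words_def)
  have "{xs :: bit list. length xs = m} = {xs. set xs \<subseteq> {0, 1} \<and> length xs = m}"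
    using UNIV by auto
  then have card: "card {xs :: bit list. length xs = m} = q"
    using card_lists_length_eq[of "{0, 1 :: bit}" m] by (simp add: q_def numeral_2_eq_2)
  have sub: "{r :: bit poly. degree r < m} \<subseteq> Poly ` {xs. length xs = m}"
  proof
    fix r :: "bit poly" assume "r \<in> {r. degree r < m}"
    then have "r = Poly (map (coeff r) [0..<m])"
      by (intro poly_eqI) (auto simp: nth_default_def intro!: coeff_eq_0)
    then show "r \<in> Poly ` {xs. length xs = m}" by (rule image_eqI) simp
  qed
  show "finite {r :: bit poly. degree r < m}"
    using sub fin by (rule finite_subset[OF _ finite_imageI])
  have "card {r :: bit poly. degree r < m} \<le> card (Poly ` {xs :: bit list. length xs = m})"
    using sub fin by (intro card_mono) auto
  also have "\<dots> \<le> q" using card_image_le[OF fin, of Poly] card by simp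
  finally show "card {r :: bit poly. degree r < m} \<le> q" .
qed

text \<open>Pigeonhole: the \<open>q\<close> remainders of the \<open>tau j\<close> are distinct,
  and at most \<open>q\<close> remainders exist.\<close>

lemma tau_surj: "\<exists>j<q. eqv2 p (tau j)"
proof -
  let ?f = "\<lambda>j. red (tau j) mod h2"
  have deg: "degree (r mod h2) < m" for r
  proof -
    have "h2 \<noteq> 0" using degree_h2 m_pos by auto
    then show ?thesis using degree_mod_less'[of h2 r] degree_h2 m_pos by (cases "r mod h2 = 0") auto
  qed
  have "inj_on ?f {..<q}"
  proof (rule inj_onI)
    fix j k assume "j \<in> {..<q}" "k \<in> {..<q}" "?f j = ?f k"
    then show "j = k" using tau_inj[of j k] by (auto simp: eqv2_def mod_eq_dvd_iff)
  qed
  then have "card (?f ` {..<q}) = q" by (simp add: card_image)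
  with small_polys(2) have "card {r :: bit poly. degree r < m} \<le> card (?f ` {..<q})" by simp
  moreover have "?f ` {..<q} \<subseteq> {r. degree r < m}" using deg by auto
  ultimately have "?f ` {..<q} = {r. degree r < m}"
    using small_polys(1) by (intro card_seteq)
  moreover have "red p mod h2 \<in> {r. degree r < m}" using deg by simp
  ultimately have "red p mod h2 \<in> ?f ` {..<q}" by blast
  then show ?thesis by (auto simp: eqv2_def mod_eq_dvd_iff)
qed

text \<open>The kernel of the map to the residue field is the ideal generated by \<open>h\<close>
  and 2: lift the cofactor of \<open>h2\<close> to Z_4, and what is left reduces to 0.\<close>

lemma eqv2_obtain:
  assumes "eqv2 p r"
  obtains g b where "p - r = h * g + 2 * b"
proof -
  obtain g where g: "red (p - r) = h2 * g" using assms by (auto simp: eqv2_def red_diff)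
  obtain g' where "red g' = g" using red_surj by blast
  then have "red (p - r - h * g') = 0" using g by (simp only: red_diff red_mult red_h) simp
  then obtain b where "p - r - h * g' = 2 * b" by (rule red_eq_0)
  then have "p - r = h * g' + 2 * b" by (simp add: algebra_simps)
  then show ?thesis by (rule that)
qed

text \<open>Modulo \<open>h\<close> one has \<open>p = r + 2 b\<close>, and
  \<open>(r + 2 b)^2 = r^2 + 4 (r b + b^2) = r^2\<close>. A square thus depends only on the residue
  of its root, which is why squares of arbitrary ring elements are Teichmueller elements.\<close>

lemma eqv2_square:
  assumes "eqv2 p r"
  shows "h dvd p ^ 2 - r ^ 2"
proof -
  obtain g b where gb: "p - r = h * g + 2 * b" using assms by (rule eqv2_obtain)
  then have p: "p = r + h * g + 2 * b" by (simp add: algebra_simps)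
  have "p ^ 2 - r ^ 2 = h * (2 * r * g + g * (h * g) + 4 * (b * g)) + 4 * (r * b + b ^ 2)"
    unfolding p by (simp add: algebra_simps power2_eq_square)
  also have "\<dots> = h * (2 * r * g + g * (h * g))" by (simp add: four_poly_eq_0)
  finally show ?thesis by simp
qed

text \<open>Index of the Teichmueller element with the same residue as \<open>p\<close>.\<close>

definition ix :: "4 poly \<Rightarrow> nat" where
  "ix p = (SOME j. j < q \<and> eqv2 p (tau j))"

lemma ix: "ix p < q" "eqv2 p (tau (ix p))"
proof -
  have "ix p < q \<and> eqv2 p (tau (ix p))"
    unfolding ix_def by (rule someI_ex) (rule tau_surj)
  then show "ix p < q" "eqv2 p (tau (ix p))" by auto
qed

lemma ix_eq_iff: "ix p = ix r \<longleftrightarrow> eqv2 p r"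
  by (metis ix eqv2_sym eqv2_trans tau_inj)

lemma ix_eqI: "j < q \<Longrightarrow> eqv2 p (tau j) \<Longrightarrow> ix p = j"
  by (metis ix eqv2_sym eqv2_trans tau_inj)

end

section \<open>Linear functionals and their exponential sums\<close>

context teichmueller
begin

section \<open>Remainders and linear functionals on Z_4[X]/(h)\<close>

definition rd :: "4 poly \<Rightarrow> 4 poly" where
  "rd p = (SOME r. degree r < m \<and> h dvd p - r)"

lemma rd: "degree (rd p) < m" "h dvd p - rd p"
proof -
  have "\<exists>r. degree r < m \<and> h dvd p - r"
    using monic_division[OF monic_h, of p] degree_h m_pos by simp
  then have "degree (rd p) < m \<and> h dvd p - rd p"
    unfolding rd_def by (rule someI_ex)
  then show "degree (rd p) < m" "h dvd p - rd p" by auto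
qed

lemma rd_eqI:
  assumes "degree r < m" "h dvd p - r"
  shows "rd p = r"
proof -
  have "h dvd (p - r) - (p - rd p)" using assms(2) rd(2) by (rule dvd_diff)
  then have "h dvd rd p - r" by simp
  moreover have "degree (rd p - r) < degree h"
    using assms(1) rd(1) degree_h by (simp add: degree_diff_less)
  ultimately have "rd p - r = 0" using monic_dvd_small[OF monic_h] by blast
  then show ?thesis by simp
qed

lemma rd_cong: "h dvd p - r \<Longrightarrow> rd p = rd r"
proof -
  assume "h dvd p - r"
  then have "h dvd (p - r) + (r - rd r)" using rd(2) by (rule dvd_add)
  then show ?thesis using rd(1) by (intro rd_eqI) simp_all
qed

lemma rd_add: "rd (p + r) = rd p + rd r"
proof (rule rd_eqI)
  have "h dvd (p - rd p) + (r - rd r)" using rd(2) rd(2) by (rule dvd_add)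
  then show "h dvd p + r - (rd p + rd r)" by (simp add: algebra_simps)
qed (simp add: degree_add_less rd(1))

lemma rd_smult: "rd (smult a p) = smult a (rd p)"
proof (rule rd_eqI)
  show "degree (smult a (rd p)) < m" using degree_smult_le[of a "rd p"] rd(1)[of p] by linarith
  have "h dvd smult a (p - rd p)" using rd(2) by (rule dvd_smult)
  then show "h dvd smult a p - smult a (rd p)" by (simp add: smult_diff_right)
qed

lemma rd_eq_0_iff: "rd p = 0 \<longleftrightarrow> h dvd p"
  using rd(2)[of p] rd_eqI[of 0 p] m_pos by auto

text \<open>The list holds the values on the basis 1, X, ..., X^(m-1); every linear functional
  arises from exactly one list of length \<open>m\<close>.\<close>

definition lam :: "4 list \<Rightarrow> 4 poly \<Rightarrow> 4" where
  "lam l p = (\<Sum>k<m. l ! k * coeff (rd p) k)"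

lemma lam_add: "lam l (p + r) = lam l p + lam l r"
  by (simp add: lam_def rd_add ring_distribs sum.distrib)

lemma lam_smult: "lam l (smult a p) = a * lam l p"
  by (simp add: lam_def rd_smult sum_distrib_left mult.left_commute)

lemma lam_cong: "h dvd p - r \<Longrightarrow> lam l p = lam l r"
  by (simp add: lam_def rd_cong)

lemma lam_0 [simp]: "lam l 0 = 0"
  using lam_smult[of l 0 0] by simp

lemma lam_sum: "lam l (sum f A) = (\<Sum>x\<in>A. lam l (f x))"
  by (induction A rule: infinite_finite_induct) (auto simp: lam_add)

lemma lam_monom:
  assumes "k < m"
  shows "lam l (monom 1 k) = l ! k"
proof -
  have "rd (monom 1 k) = monom 1 k"
    using assms by (intro rd_eqI) (auto simp: degree_monom_eq)
  then have "lam l (monom 1 k) = (\<Sum>j<m. if j = k then l ! j else 0)"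
    unfolding lam_def by (intro sum.cong) auto
  then show ?thesis using assms by simp
qed

text \<open>A functional kills the multiples of \<open>h\<close>, and doubling kills what comes from
  the ideal generated by 2.\<close>

lemma two_lam_cong:
  assumes "eqv2 p r"
  shows "2 * lam l p = 2 * lam l r"
proof -
  obtain g b where "p - r = h * g + 2 * b" using assms by (rule eqv2_obtain)
  then have "p - (r + (b + b)) = h * g" by (simp add: algebra_simps)
  then have "lam l p = lam l (r + (b + b))" by (intro lam_cong) simp
  then have "lam l p = lam l r + (lam l b + lam l b)" by (simp only: lam_add)
  then have "2 * lam l p = 2 * lam l r + 4 * lam l b" by (simp only: algebra_simps) simp
  moreover have "(4 :: 4) = 0" by simp
  ultimately show ?thesis by (simp only: mult_zero_left add_0_right)
qed

lemma two_lam_ix: "2 * lam l (tau (ix p)) = 2 * lam l p"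
  using eqv2_sym[OF ix(2)] by (rule two_lam_cong)

lemma lam_ix_square: "lam l (tau (ix p) ^ 2) = lam l (p ^ 2)"
  using eqv2_square[OF eqv2_sym[OF ix(2)]] by (rule lam_cong)

text \<open>A map that is injective on residues permutes the Teichmueller indices. All substitutions
  in the exponential sums go through this.\<close>

lemma sum_reindex_ix:
  assumes "\<And>j k. j < q \<Longrightarrow> k < q \<Longrightarrow> eqv2 (f j) (f k) \<Longrightarrow> eqv2 (tau j) (tau k)"
  shows "(\<Sum>j<q. F (ix (f j))) = (\<Sum>j<q. F j)"
proof (rule sum_reindex_lessThan[of q "\<lambda>j. ix (f j)" F])
  show "inj_on (\<lambda>j. ix (f j)) {..<q}"
  proof (rule inj_onI)
    fix j k assume "j \<in> {..<q}" "k \<in> {..<q}" "ix (f j) = ix (f k)"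
    then have "j < q" "k < q" "eqv2 (f j) (f k)" by (simp_all add: ix_eq_iff)
    then show "j = k" using assms tau_inj by blast
  qed
qed (rule ix)

text \<open>\<open>chi (2 * x) = -1\<close> singles out the units 1 and 3, so the functional is
  nonzero modulo 2. The sign is the form in which the translation argument uses this.\<close>

definition odd_word :: "4 list \<Rightarrow> bool" where
  "odd_word l \<longleftrightarrow> (\<exists>k<m. chi (2 * l ! k) = -1)"

text \<open>Adding \<open>X^k\<close> permutes the residues and turns every term into its
  negative.\<close>

lemma sum_chi_two_lam:
  assumes "odd_word l"
  shows "(\<Sum>j<q. chi (2 * lam l (tau j))) = 0"
proof -
  let ?f = "\<lambda>j. chi (2 * lam l (tau j))"
  obtain k where k: "k < m" "chi (2 * l ! k) = -1" using assms by (auto simp: odd_word_def)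
  have "(\<Sum>j<q. ?f j) = (\<Sum>j<q. ?f (ix (tau j + monom 1 k)))"
    by (rule sum_reindex_ix[symmetric]) (simp add: eqv2_def red_add)
  also have "\<dots> = (\<Sum>j<q. chi (2 * lam l (tau j + monom 1 k)))"
    by (simp only: two_lam_ix)
  also have "\<dots> = (\<Sum>j<q. - ?f j)"
    using k by (simp add: lam_add lam_monom ring_distribs chi_add)
  also have "\<dots> = - (\<Sum>j<q. ?f j)" by (rule sum_negf)
  finally show ?thesis by simp
qed

text \<open>\<open>X^n\<close> is 1 modulo \<open>h\<close> and not only modulo \<open>h2\<close>,
  so exponents may be reduced modulo \<open>n\<close> in the Galois ring itself: the square of a
  Teichmueller element is again one.\<close>

lemma ix_tau_square:
  assumes "j < q"
  shows "h dvd tau j ^ 2 - tau (ix (tau j ^ 2))"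
proof (cases "j = 0")
  case True
  have "ix 0 = 0" using n_pos by (intro ix_eqI) (auto simp: q_eq tau_def eqv2_refl)
  with True show ?thesis by (simp add: tau_def)
next
  case False
  let ?e = "2 * (j - 1)"
  define r where "r = ?e mod n"
  have pow: "h dvd monom 1 (k * n) - 1" for k
  proof -
    have "monom 1 n - 1 dvd monom 1 n ^ k - (1 :: 4 poly)"
      by (cases "k = 0") (simp_all add: power_diff_1_eq)
    then show ?thesis using h_dvd by (auto simp: monom_power mult.commute intro: dvd_trans)
  qed
  have "monom 1 ?e = monom 1 (r + ?e div n * n)" by (simp add: r_def)
  then have "monom 1 ?e - monom 1 r = monom 1 r * (monom 1 (?e div n * n) - (1 :: 4 poly))"
    by (simp add: mult_monom algebra_simps)
  then have "h dvd monom 1 ?e - monom 1 r" using pow by simp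
  moreover have "tau j ^ 2 = monom 1 ?e" using False by (simp add: tau_def monom_power mult.commute)
  moreover have "tau (Suc r) = monom 1 r" by (simp add: tau_def)
  ultimately have *: "h dvd tau j ^ 2 - tau (Suc r)" by simp
  moreover have "Suc r < q" using n_pos by (simp add: q_eq r_def)
  ultimately have "ix (tau j ^ 2) = Suc r" by (intro ix_eqI eqv2_if_dvd)
  with * show ?thesis by simp
qed

lemma eqv2_mult_cancel:
  assumes "eqv2 (p * s) (r * s)" "\<not> h2 dvd red s"
  shows "eqv2 p r"
proof -
  have "h2 dvd (red p - red r) * red s" using assms(1) by (simp add: eqv2_def red_mult left_diff_distrib)
  then show ?thesis using prime_elem_dvd_multD[OF prime_h2] assms(2) by (auto simp: eqv2_def)
qed

lemma bit_poly_square_diff: "(a - b) ^ 2 = a ^ 2 - (b :: bit poly) ^ 2"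
proof -
  have "(2 :: bit poly) = 0" by (simp add: numeral_poly)
  moreover have "(a - b) ^ 2 = a ^ 2 - b ^ 2 + 2 * (b ^ 2 - a * b)"
    by (simp add: power2_eq_square algebra_simps)
  ultimately show ?thesis by simp
qed

text \<open>Frobenius is injective: in characteristic 2 the difference of the squares is the square
  of the difference.\<close>

lemma eqv2_square_cancel:
  assumes "eqv2 (p ^ 2) (r ^ 2)"
  shows "eqv2 p r"
proof -
  have "(red p - red r) ^ 2 = red p ^ 2 - red r ^ 2" by (rule bit_poly_square_diff)
  also have "\<dots> = red (p ^ 2) - red (r ^ 2)" by (simp only: power2_eq_square red_mult)
  finally have "h2 dvd (red p - red r) ^ 2" using assms by (simp only: eqv2_def)
  then show ?thesis using prime_elem_dvd_power[OF prime_h2] by (auto simp: eqv2_def)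
qed

definition S :: "4 list \<Rightarrow> complex" where
  "S l = (\<Sum>j<q. chi (lam l (tau j)))"

text \<open>Squaring permutes the Teichmueller set.\<close>

lemma sum_chi_square: "(\<Sum>j<q. chi (lam l (tau j ^ 2))) = S l"
proof -
  have "S l = (\<Sum>j<q. chi (lam l (tau (ix (tau j ^ 2)))))"
    unfolding S_def by (rule sum_reindex_ix[symmetric]) (rule eqv2_square_cancel)
  also have "\<dots> = (\<Sum>j<q. chi (lam l (tau j ^ 2)))"
  proof (intro sum.cong refl)
    fix j assume "j \<in> {..<q}"
    then have "lam l (tau j ^ 2) = lam l (tau (ix (tau j ^ 2)))"
      by (intro lam_cong ix_tau_square) simp
    then show "chi (lam l (tau (ix (tau j ^ 2)))) = chi (lam l (tau j ^ 2))" by simp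
  qed
  finally show ?thesis by simp
qed

text \<open>Replacing \<open>p + tau w\<close> by its Teichmueller representative does not change
  the square, and these representatives run through the whole set.\<close>

lemma sum_chi_square_shift: "(\<Sum>w<q. chi (lam l ((p + tau w) ^ 2))) = S l"
proof -
  have "(\<Sum>j<q. chi (lam l (tau j ^ 2))) = (\<Sum>w<q. chi (lam l (tau (ix (p + tau w)) ^ 2)))"
    by (rule sum_reindex_ix[symmetric]) (simp add: eqv2_def red_add)
  then show ?thesis by (simp only: lam_ix_square sum_chi_square)
qed

text \<open>Write the conjugate factor as a sum over the squares \<open>p^2\<close> and, for each
  \<open>p\<close>, the factor \<open>S l\<close> as a sum over the squares
  \<open>(p + w)^2\<close>. The squares differ by \<open>w^2 + 2 p w\<close>, and summing over
  \<open>p\<close> first leaves only \<open>w = 0\<close>.\<close>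

lemma S_norm:
  assumes "odd_word l"
  shows "S l * cnj (S l) = of_nat q"
proof -
  have "S l * cnj (S l) = (\<Sum>p<q. cnj (chi (lam l (tau p ^ 2))) * S l)"
    by (subst (2) sum_chi_square[symmetric]) (simp add: sum_distrib_left sum_distrib_right mult.commute)
  also have "\<dots> = (\<Sum>p<q. \<Sum>w<q. chi (- lam l (tau p ^ 2)) * chi (lam l ((tau p + tau w) ^ 2)))"
    by (intro sum.cong refl, subst sum_chi_square_shift[symmetric]) (simp add: cnj_chi sum_distrib_left)
  also have "\<dots> = (\<Sum>p<q. \<Sum>w<q. chi (lam l (tau w ^ 2)) * chi (2 * lam l (tau p * tau w)))"
  proof (intro sum.cong refl)
    fix p w
    have sq: "(tau p + tau w) ^ 2 = tau p ^ 2 + (tau w ^ 2 + (tau p * tau w + tau p * tau w))"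
      by (simp add: power2_eq_square algebra_simps)
    show "chi (- lam l (tau p ^ 2)) * chi (lam l ((tau p + tau w) ^ 2))
        = chi (lam l (tau w ^ 2)) * chi (2 * lam l (tau p * tau w))"
      unfolding sq lam_add mult_2 chi_add[symmetric] by (simp only: minus_add_cancel)
  qed
  also have "\<dots> = (\<Sum>w<q. chi (lam l (tau w ^ 2)) * (\<Sum>p<q. chi (2 * lam l (tau p * tau w))))"
    by (subst sum.swap) (simp add: sum_distrib_left)
  also have "\<dots> = (\<Sum>w<q. if w = 0 then of_nat q else 0)"
  proof (intro sum.cong refl)
    fix w assume w: "w \<in> {..<q}"
    show "chi (lam l (tau w ^ 2)) * (\<Sum>p<q. chi (2 * lam l (tau p * tau w))) = (if w = 0 then of_nat q else 0)"
    proof (cases "w = 0")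
      case True
      then show ?thesis by (simp add: tau_def)
    next
      case False
      then have *: "\<not> h2 dvd red (tau w)" using not_h2_dvd_monom by (simp add: tau_def red_monom)
      \<comment> \<open>Multiplication by the nonzero residue of \<open>tau w\<close> permutes the
        residues.\<close>
      have "(\<Sum>j<q. chi (2 * lam l (tau j))) = (\<Sum>p<q. chi (2 * lam l (tau (ix (tau p * tau w)))))"
        by (rule sum_reindex_ix[symmetric]) (rule eqv2_mult_cancel[OF _ *])
      also have "\<dots> = (\<Sum>p<q. chi (2 * lam l (tau p * tau w)))"
        by (simp only: two_lam_ix)
      finally show ?thesis using False sum_chi_two_lam[OF assms] by simp
    qed
  qed
  also have "\<dots> = of_nat q"
  proof -
    have "0 < q" by (simp add: q_def)
    then show ?thesis by simp
  qed
  finally show ?thesis .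
qed

end

section \<open>Lee weights of the dual words\<close>

text \<open>Squares are 0 or 1 modulo 4, so both numbers are even as long as 4 divides the sum;
  halving them descends to the case 1 + 1 = 2.\<close>

lemma sum_two_squares_eq:
  fixes x y :: int
  assumes "x ^ 2 + y ^ 2 = 2 * 4 ^ k"
  shows "\<bar>x\<bar> = 2 ^ k \<and> \<bar>y\<bar> = 2 ^ k"
  using assms
proof (induction k arbitrary: x y)
  case 0
  then have *: "x ^ 2 + y ^ 2 = 2" by simp
  have bound: "\<bar>z\<bar> \<le> 1" if "z ^ 2 \<le> 2" for z :: int
  proof (rule ccontr)
    assume "\<not> ?thesis"
    then have "2 ^ 2 \<le> \<bar>z\<bar> ^ 2" by (intro power_mono) auto
    with that show False by simp
  qed
  have "\<bar>x\<bar> \<le> 1" "\<bar>y\<bar> \<le> 1" using bound[of x] bound[of y] * by (smt (verit) zero_le_power2)+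
  then have "x \<in> {-1, 0, 1}" "y \<in> {-1, 0, 1}" by auto
  with * show ?case by auto
next
  case (Suc k)
  have sq: "(2 * z + 1) ^ 2 = 4 * (z ^ 2 + z) + 1" for z :: int
    by (simp add: power2_eq_square algebra_simps)
  have sq': "(2 * z) ^ 2 = 4 * z ^ 2" for z :: int by simp
  have "even x \<and> even y"
  proof (rule ccontr)
    assume *: "\<not> ?thesis"
    have "x ^ 2 + y ^ 2 = 4 * (2 * 4 ^ k)" using Suc.prems by simp
    moreover have "\<exists>w. z ^ 2 = 4 * w \<and> even z \<or> z ^ 2 = 4 * w + 1 \<and> odd z" for z :: int
    proof (cases "even z")
      case True
      then obtain b where "z = 2 * b" ..
      then show ?thesis using sq'[of b] True by blast
    next
      case False
      then obtain b where "z = 2 * b + 1" ..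
      then show ?thesis using sq[of b] False by blast
    qed
    then obtain w w' where "x ^ 2 = 4 * w \<and> even x \<or> x ^ 2 = 4 * w + 1 \<and> odd x"
      "y ^ 2 = 4 * w' \<and> even y \<or> y ^ 2 = 4 * w' + 1 \<and> odd y" by metis
    ultimately show False using * by presburger
  qed
  then obtain x' y' where xy: "x = 2 * x'" "y = 2 * y'" by (auto elim!: evenE)
  with Suc.prems have "x' ^ 2 + y' ^ 2 = 2 * 4 ^ k" by simp
  from Suc.IH[OF this] show ?case by (simp add: xy abs_mult)
qed

lemma lee_eq_Re_chi: "real (lee x) = 1 - Re (chi x)"
proof -
  have "\<forall>x. real (lee x) = 1 - Re (chi x)"
    by (simp add: all_4 lee_def chi_def)
  then show ?thesis by blast
qed

lemma Re_Im_chi_int: "Re (chi x) \<in> \<int>" "Im (chi x) \<in> \<int>"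
  by (simp_all add: chi_def)

lemma lee_le_2: "lee x \<le> 2"
  by (simp add: lee_def)

lemma lee_add_2: "lee (x + 2) = 2 - lee x"
proof -
  have "\<forall>x. lee (x + 2) = 2 - lee x"
    by (simp add: all_4 lee_def)
  then show ?thesis by blast
qed

lemma chi_two_eq: "chi (2 * x) = (if x = 0 \<or> x = 2 then 1 else -1)"
proof -
  have "\<forall>x. chi (2 * x) = (if x = 0 \<or> x = 2 then 1 else -1)"
    by (simp add: all_4 chi_def)
  then show ?thesis by blast
qed

context teichmueller
begin

definition a :: nat where "a = 2 ^ (m div 2)"

lemma q_eq_a: "q = 2 * a ^ 2"
proof -
  have "m = Suc (2 * (m div 2))" using odd_m by simp
  then have "q = 2 ^ Suc (2 * (m div 2))" unfolding q_def by (rule arg_cong)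
  then show ?thesis by (simp add: a_def power_mult[symmetric] mult.commute)
qed

lemma a_pos: "a > 0" by (simp add: a_def)

lemma a_less_q: "a < q"
proof -
  have "a * 1 \<le> a * a" using a_pos by (intro mult_le_mono) auto
  then show ?thesis using a_pos by (simp add: q_eq_a power2_eq_square)
qed

text \<open>The pair \<open>(e, l)\<close> stands for the dual word with entries
  \<open>e + lam l (tau j)\<close>.\<close>

definition weight :: "4 \<times> 4 list \<Rightarrow> nat" where
  "weight u = (\<Sum>j<q. lee (fst u + lam (snd u) (tau j)))"

lemma weight_eq_Re: "real (weight u) = real q - Re (chi (fst u) * S (snd u))"
proof -
  have "real (weight u) = (\<Sum>j<q. 1 - Re (chi (fst u) * chi (lam (snd u) (tau j))))"
    by (simp add: weight_def lee_eq_Re_chi chi_add)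
  then show ?thesis by (simp add: sum_subtractf S_def sum_distrib_left)
qed

lemma weight_shift: "weight (e + 2, l) = 2 * q - weight (e, l)"
proof -
  have "weight (e + 2, l) = (\<Sum>j<q. lee ((e + lam l (tau j)) + 2))"
    by (simp add: weight_def algebra_simps)
  then have "weight (e + 2, l) = (\<Sum>j<q. 2 - lee (e + lam l (tau j)))"
    by (simp only: lee_add_2)
  also have "\<dots> = 2 * q - weight (e, l)"
    by (subst sum_subtractf_nat) (auto simp: weight_def lee_le_2)
  finally show ?thesis .
qed

text \<open>\<open>S l\<close> is a Gaussian integer of norm \<open>q\<close>, twice a power of
  4.\<close>

lemma S_odd:
  assumes "odd_word l"
  shows "\<bar>Re (S l)\<bar> = real a \<and> \<bar>Im (S l)\<bar> = real a"
proof -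
  have "Re (S l) \<in> \<int>" "Im (S l) \<in> \<int>"
    unfolding S_def by (auto intro!: Ints_sum Re_Im_chi_int simp: Re_sum Im_sum)
  then obtain x y where xy: "Re (S l) = of_int x" "Im (S l) = of_int y"
    by (auto elim!: Ints_cases)
  have "complex_of_real (Re (S l) ^ 2 + Im (S l) ^ 2) = complex_of_real (real q)"
    using S_norm[OF assms] by (simp add: complex_mult_cnj)
  then have "Re (S l) ^ 2 + Im (S l) ^ 2 = real q" by (simp only: of_real_eq_iff)
  then have "real_of_int (x ^ 2 + y ^ 2) = real_of_int (int q)" by (simp add: xy)
  then have "x ^ 2 + y ^ 2 = int q" by (simp only: of_int_eq_iff)
  also have "int q = 2 * 4 ^ (m div 2)"
    by (simp add: q_eq_a a_def power_mult[symmetric] mult.commute power_mult[of 2 2, simplified])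
  finally have "\<bar>x\<bar> = 2 ^ (m div 2) \<and> \<bar>y\<bar> = 2 ^ (m div 2)" by (rule sum_two_squares_eq)
  then show ?thesis unfolding xy by (simp add: a_def flip: of_int_abs)
qed

lemma weight_odd:
  assumes "odd_word l"
  shows "weight (e, l) = q - a \<or> weight (e, l) = q + a"
proof -
  \<comment> \<open>\<open>chi e\<close> is a power of \<i>, so up to sign the real part of the
    product is the real or the imaginary part of \<open>S l\<close>.\<close>
  have "\<bar>Re (chi e * S l)\<bar> = real a"
    using S_odd[OF assms] by (auto simp: chi_def)
  then have "real (weight (e, l)) = real q - real a \<or> real (weight (e, l)) = real q + real a"
    using weight_eq_Re[of "(e, l)"] by (auto simp: abs_if split: if_splits)
  then show ?thesis using a_less_q by auto
qed

lemma S_zero: "S (replicate m 0) = of_nat q"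
proof -
  have "lam (replicate m 0) p = 0" for p by (simp add: lam_def)
  then show ?thesis by (simp add: S_def)
qed

text \<open>All entries are 0 or 2, so the functional is twice an odd one, obtained by halving the
  entries; the sum for doubled odd functionals vanishes.\<close>

lemma S_even:
  assumes "length l = m" "\<not> odd_word l" "l \<noteq> replicate m 0"
  shows "S l = 0"
proof -
  have l: "l ! k = 0 \<or> l ! k = 2" if "k < m" for k
    using assms(2) that by (auto simp: odd_word_def chi_two_eq split: if_splits)
  let ?\<mu> = "map (\<lambda>x. if x = 2 then 1 else 0) l :: 4 list"
  have lam: "lam l p = 2 * lam ?\<mu> p" for p
    unfolding lam_def sum_distrib_left
  proof (intro sum.cong refl)
    fix k assume "k \<in> {..<m}"
    then show "l ! k * coeff (rd p) k = 2 * (?\<mu> ! k * coeff (rd p) k)"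
      using l[of k] assms(1) by auto
  qed
  have "\<exists>k<m. l ! k \<noteq> 0"
  proof (rule ccontr)
    assume "\<not> ?thesis"
    then have "l = replicate m 0" using assms(1) by (intro nth_equalityI) auto
    with assms(3) show False by simp
  qed
  then obtain k where "k < m" "l ! k = 2" using l by blast
  then have "odd_word ?\<mu>" using assms(1) by (auto simp: odd_word_def chi_two_eq intro!: exI[of _ k])
  then show ?thesis using sum_chi_two_lam[of ?\<mu>] by (simp only: S_def lam)
qed

text \<open>Labels of the dual words; there are \<open>4 * 4^m = 4 * q^2\<close> of them.\<close>

definition U :: "(4 \<times> 4 list) set" where
  "U = UNIV \<times> {l. length l = m}"

lemma finite_U: "finite U"
  using finite_lists_length_eq[of "UNIV :: 4 set" m] by (simp add: U_def)

lemma weight_zero: "weight (e, replicate m 0) = q * lee e"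
proof -
  have "real (weight (e, replicate m 0)) = real q * (1 - Re (chi e))"
    unfolding weight_eq_Re by (simp add: S_zero algebra_simps)
  also have "\<dots> = real (q * lee e)" by (simp add: lee_eq_Re_chi)
  finally show ?thesis by (simp only: of_nat_eq_iff)
qed

lemma weight_even:
  assumes "length l = m" "\<not> odd_word l" "l \<noteq> replicate m 0"
  shows "weight (e, l) = q"
  using weight_eq_Re[of "(e, l)"] S_even[OF assms] by simp

lemma q_pos: "q > 0" by (simp add: q_def)

lemma weight_cases:
  assumes "u \<in> U"
  shows "weight u \<in> {0, q, 2 * q, q - a, q + a}"
proof -
  obtain e l where u: "u = (e, l)" "length l = m" using assms by (auto simp: U_def)
  consider "odd_word l" | "l = replicate m 0" | "\<not> odd_word l" "l \<noteq> replicate m 0" by blast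
  then show ?thesis
  proof cases
    case 1 then show ?thesis using weight_odd u by auto
  next
    case 2 then show ?thesis using weight_zero[of e] u by (auto simp: lee_def)
  next
    case 3 then show ?thesis using weight_even u by auto
  qed
qed

lemma not_odd_word_zero: "\<not> odd_word (replicate m 0)"
  by (simp add: odd_word_def)

lemma weight_eq_q_iff:
  assumes "u \<in> U"
  shows "weight u = q \<longleftrightarrow> \<not> odd_word (snd u) \<and> u \<noteq> (0, replicate m 0) \<and> u \<noteq> (2, replicate m 0)"
proof -
  obtain e l where u: "u = (e, l)" "length l = m" using assms by (auto simp: U_def)
  consider "odd_word l" | "l = replicate m 0" | "\<not> odd_word l" "l \<noteq> replicate m 0" by blast
  then show ?thesis
  proof cases
    case 1 then show ?thesis using weight_odd[of l e] u a_pos a_less_q by auto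
  next
    case 2 then show ?thesis using weight_zero[of e] u q_pos not_odd_word_zero by (auto simp: lee_def)
  next
    case 3 then show ?thesis using weight_even u by auto
  qed
qed

lemma weight_eq_0_iff:
  assumes "u \<in> U"
  shows "weight u = 0 \<longleftrightarrow> u = (0, replicate m 0)"
proof -
  obtain e l where u: "u = (e, l)" "length l = m" using assms by (auto simp: U_def)
  consider "odd_word l" | "l = replicate m 0" | "\<not> odd_word l" "l \<noteq> replicate m 0" by blast
  then show ?thesis
  proof cases
    case 1 then show ?thesis using weight_odd[of l e] u a_pos a_less_q not_odd_word_zero by auto
  next
    case 2 then show ?thesis using weight_zero[of e] u q_pos by (auto simp: lee_def split: if_splits)
  next
    case 3 then show ?thesis using weight_even u q_pos by auto
  qed
qed

text \<open>There are \<open>4 * q\<close> pairs with all entries of \<open>l\<close> in {0, 2}. Of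
  these only the two with \<open>l = 0\<close> and \<open>e\<close> in {0, 2} have another weight,
  namely 0 and \<open>2 * q\<close>.\<close>

lemma card_weight_q: "card {u \<in> U. weight u = q} = 4 * q - 2"
proof -
  let ?E = "{l :: 4 list. length l = m \<and> \<not> odd_word l}"
  have "?E = {l. set l \<subseteq> {0, 2} \<and> length l = m}"
    by (auto simp: odd_word_def chi_two_eq in_set_conv_nth subset_iff split: if_splits)
  then have cardE: "card ?E = q" and finE: "finite ?E"
    using card_lists_length_eq[of "{0, 2 :: 4}" m] finite_lists_length_eq[of "{0, 2 :: 4}" m]
    by (simp_all add: q_def numeral_2_eq_2)
  let ?z = "replicate m (0 :: 4)"
  have "{u \<in> U. weight u = q} = UNIV \<times> ?E - {(0, ?z), (2, ?z)}"
    using weight_eq_q_iff by (auto simp: U_def)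
  moreover have "{(0 :: 4, ?z), (2, ?z)} \<subseteq> UNIV \<times> ?E" using not_odd_word_zero by auto
  ultimately have "card {u \<in> U. weight u = q} = card (UNIV \<times> ?E :: (4 \<times> 4 list) set) - card {(0 :: 4, ?z), (2, ?z)}"
    by (simp only: card_Diff_subset finite.emptyI finite.insertI)
  also have "card {(0 :: 4, ?z), (2, ?z)} = 2" by simp
  finally show ?thesis using cardE finE by (simp add: card_cartesian_product)
qed

end

section \<open>Poisson summation\<close>

lemma Poly_eq_sum:
  fixes c :: "'a::comm_semiring_1 list"
  shows "Poly c = (\<Sum>t<length c. smult (c ! t) (monom 1 t))"
  by (rule poly_eqI) (simp add: coeff_sum nth_default_def if_distrib cong: if_cong)

lemma smult_sum_right: "smult c (sum f A) = (\<Sum>x\<in>A. smult c (f x))"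
  by (induction A rule: infinite_finite_induct) (auto simp: smult_add_right)

lemma prod_monom: "(\<Prod>x\<in>A. monom 1 (f x)) = monom (1 :: 'a::comm_semiring_1) (sum f A)"
  by (induction A rule: infinite_finite_induct) (auto simp: mult_monom)

text \<open>Generating polynomial of the Krawtchouk values at \<open>k\<close>: the MacWilliams
  transform of a dual word of weight \<open>k\<close> in length \<open>N\<close>.\<close>

definition gen :: "nat \<Rightarrow> nat \<Rightarrow> complex poly" where
  "gen N k = [:1, 1:] ^ (N - k) * [:1, -1:] ^ k"

text \<open>The MacWilliams transform in a single coordinate, checked on the 16 pairs
  \<open>z\<close>, \<open>u\<close>.\<close>

lemma sum_chi_lee:
  "(\<Sum>b\<in>UNIV. smult (chi (b * u)) (monom 1 (lee (z - b)))) = smult (chi (z * u)) (gen 2 (lee u))"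
proof -
  have "\<forall>z u. (\<Sum>b\<in>UNIV. smult (chi (b * u)) (monom 1 (lee (z - b)))) = smult (chi (z * u)) (gen 2 (lee u))"
    by (simp add: all_4 sum_4 chi_def lee_def gen_def monom_altdef power2_eq_square one_pCons numeral_poly)
  then show ?thesis by blast
qed

lemma prod_gen:
  fixes f :: "nat \<Rightarrow> 4"
  shows "(\<Prod>j<q. gen 2 (lee (f j))) = gen (2 * q) (\<Sum>j<q. lee (f j))"
proof -
  have "(\<Sum>j<q. 2 - lee (f j)) = 2 * q - (\<Sum>j<q. lee (f j))"
    by (subst sum_subtractf_nat) (auto simp: lee_le_2)
  then show ?thesis by (simp add: gen_def prod.distrib power_sum[symmetric])
qed

context teichmueller
begin

section \<open>The code as a kernel and its indicator function as a character sum\<close>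

abbreviation code :: "4 list set" where
  "code \<equiv> preparata_Z4 n h"

text \<open>Since \<open>h\<close> divides \<open>X^n - 1\<close>, membership in the ideal of the
  quotient ring is plain divisibility by \<open>h\<close>. The parity check columns are therefore
  the pairs \<open>(1, tau j)\<close>.\<close>

lemma mem_code_iff:
  "c \<in> code \<longleftrightarrow> length c = q \<and> sum_list c = 0 \<and> h dvd (\<Sum>j<q. smult (c ! j) (tau j))"
proof -
  have cyc: "(\<exists>g. monom 1 n - 1 dvd p - g * h) \<longleftrightarrow> h dvd p" for p
  proof
    assume "\<exists>g. monom 1 n - 1 dvd p - g * h"
    then obtain g where "h dvd p - g * h" using h_dvd dvd_trans by blast
    then have "h dvd (p - g * h) + g * h" by (intro dvd_add) simp_all
    then show "h dvd p" by simp
  next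
    assume "h dvd p"
    then obtain g where "p = h * g" by blast
    then have "monom 1 n - 1 dvd p - g * h" by (simp add: mult.commute)
    then show "\<exists>g. monom 1 n - 1 dvd p - g * h" by blast
  qed
  have sum: "(\<Sum>j<q. smult ((x # c') ! j) (tau j)) = Poly c'" if "length c' = n" for x c'
    unfolding q_eq sum.lessThan_Suc_shift using that by (simp add: tau_def Poly_eq_sum)
  show ?thesis
  proof (cases c)
    case Nil
    then show ?thesis by (auto simp: preparata_Z4_def adjoin_check_def q_eq)
  next
    case (Cons x c')
    have "c \<in> code \<longleftrightarrow> x = - sum_list c' \<and> length c' = n \<and> h dvd Poly c'"
      unfolding preparata_Z4_def adjoin_check_def cyclic_code_def cyc Cons by auto
    moreover have "x = - sum_list c' \<longleftrightarrow> sum_list c = 0"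
      unfolding Cons by (simp add: eq_neg_iff_add_eq_0)
    moreover have "length c' = n \<longleftrightarrow> length c = q" by (simp add: Cons q_eq)
    moreover have "length c' = n \<Longrightarrow> (\<Sum>j<q. smult (c ! j) (tau j)) = Poly c'"
      unfolding Cons by (rule sum)
    ultimately show ?thesis by metis
  qed
qed

text \<open>Character value of the inner product of \<open>z\<close> with the dual word labelled
  \<open>u\<close>.\<close>

definition pairing :: "4 list \<Rightarrow> 4 \<times> 4 list \<Rightarrow> complex" where
  "pairing z u = (\<Prod>j<q. chi (z ! j * (fst u + lam (snd u) (tau j))))"

lemma pairing_eq:
  assumes "length z = q"
  shows "pairing z (e, l) = chi (e * sum_list z) * chi (lam l (\<Sum>j<q. smult (z ! j) (tau j)))"
proof -
  have "pairing z (e, l) = (\<Prod>j<q. chi (e * z ! j) * chi (z ! j * lam l (tau j)))"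
    by (simp add: pairing_def ring_distribs chi_add mult.commute)
  also have "\<dots> = chi (\<Sum>j<q. e * z ! j) * chi (\<Sum>j<q. z ! j * lam l (tau j))"
    by (simp add: prod.distrib chi_sum)
  also have "(\<Sum>j<q. e * z ! j) = e * sum_list z"
    using assms by (simp add: sum_list_sum_nth atLeast0LessThan sum_distrib_left)
  finally show ?thesis by (simp add: lam_sum lam_smult)
qed

text \<open>Orthogonality of characters: the sum factors over the coefficients of the remainder, and
  a single nonzero coefficient makes its factor 0.\<close>

lemma sum_chi_lam: "(\<Sum>l | length l = m. chi (lam l p)) = (if h dvd p then of_nat (q ^ 2) else 0)"
proof -
  have "(\<Sum>l | length l = m. chi (lam l p)) = (\<Sum>l | length l = m. \<Prod>k<m. chi (l ! k * coeff (rd p) k))"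
    by (simp add: lam_def chi_sum)
  also have "\<dots> = (\<Prod>k<m. \<Sum>b\<in>UNIV. chi (b * coeff (rd p) k))"
    by (rule sum_prod_lists)
  also have "\<dots> = (\<Prod>k<m. if coeff (rd p) k = 0 then 4 else 0)"
    by (simp only: sum_chi_mult)
  also have "\<dots> = (if h dvd p then of_nat (q ^ 2) else 0)"
  proof (cases "rd p = 0")
    case True
    have "(4 :: nat) ^ m = q ^ 2"
      unfolding q_def by (simp add: power2_eq_square flip: power_mult_distrib)
    then have "(4 :: complex) ^ m = of_nat (q ^ 2)"
      by (metis of_nat_numeral of_nat_power)
    moreover have "(\<Prod>k<m. if coeff (rd p) k = 0 then 4 else 0) = (4 :: complex) ^ m"
      using True by simp
    ultimately show ?thesis using True rd_eq_0_iff[of p] by simp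
  next
    case False
    then have "\<exists>k<m. coeff (rd p) k \<noteq> 0"
      using rd(1)[of p] leading_coeff_0_iff by blast
    then have "(\<Prod>k<m. if coeff (rd p) k = 0 then 4 else 0 :: complex) = 0"
      by (intro prod_zero) auto
    then show ?thesis using False rd_eq_0_iff[of p] by simp
  qed
  finally show ?thesis .
qed

text \<open>Fourier expansion of the indicator function of the code, by orthogonality in both
  components.\<close>

lemma sum_pairing:
  assumes "length c = q"
  shows "(\<Sum>u\<in>U. pairing c u) = (if c \<in> code then of_nat (4 * q ^ 2) else 0)"
proof -
  have "(\<Sum>u\<in>U. pairing c u) = (\<Sum>e\<in>UNIV. \<Sum>l | length l = m. pairing c (e, l))"
    by (simp add: U_def sum.cartesian_product)
  also have "\<dots> = (\<Sum>e\<in>UNIV. chi (e * sum_list c)) * (\<Sum>l | length l = m. chi (lam l (\<Sum>j<q. smult (c ! j) (tau j))))"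
    by (simp add: pairing_eq[OF assms] sum_product)
  finally show ?thesis using assms unfolding sum_chi_mult sum_chi_lam mem_code_iff by simp
qed

text \<open>Lee weight enumerator of the translate of the code by \<open>z\<close>, over the complex
  numbers because characters enter.\<close>

definition enumerator :: "4 list \<Rightarrow> complex poly" where
  "enumerator z = (\<Sum>c\<in>code. monom 1 (\<Sum>j<q. lee (z ! j - c ! j)))"

lemma finite_lists_q: "finite {c :: 4 list. length c = q}"
  using finite_lists_length_eq[of "UNIV :: 4 set" q] by simp

text \<open>Poisson summation: the indicator function of the code becomes a sum of dual characters,
  the sums are exchanged, and the inner sum over all words factors into coordinates.\<close>

lemma enumerator_eq:
  "smult (of_nat (4 * q ^ 2)) (enumerator z) = (\<Sum>u\<in>U. smult (pairing z u) (gen (2 * q) (weight u)))"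
proof -
  let ?W = "\<lambda>c. monom 1 (\<Sum>j<q. lee (z ! j - c ! j)) :: complex poly"
  have "code \<subseteq> {c. length c = q}" using mem_code_iff by blast
  then have "smult (of_nat (4 * q ^ 2)) (enumerator z)
      = (\<Sum>c | length c = q. if c \<in> code then smult (of_nat (4 * q ^ 2)) (?W c) else 0)"
    unfolding enumerator_def smult_sum_right
    by (subst sum.inter_restrict[OF finite_lists_q, symmetric]) (simp add: Int_absorb1)
  also have "\<dots> = (\<Sum>c | length c = q. \<Sum>u\<in>U. smult (pairing c u) (?W c))"
  proof (intro sum.cong refl)
    fix c :: "4 list" assume "c \<in> {c. length c = q}"
    then show "(if c \<in> code then smult (of_nat (4 * q ^ 2)) (?W c) else 0) = (\<Sum>u\<in>U. smult (pairing c u) (?W c))"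
      using sum_pairing[of c] by (simp flip: smult_sum)
  qed
  also have "\<dots> = (\<Sum>u\<in>U. \<Sum>c | length c = q. smult (pairing c u) (?W c))"
    by (rule sum.swap)
  also have "\<dots> = (\<Sum>u\<in>U. smult (pairing z u) (gen (2 * q) (weight u)))"
  proof (intro sum.cong refl)
    fix u assume "u \<in> U"
    let ?u = "\<lambda>j. fst u + lam (snd u) (tau j)"
    have "(\<Sum>c | length c = q. smult (pairing c u) (?W c))
        = (\<Sum>c | length c = q. \<Prod>j<q. smult (chi (c ! j * ?u j)) (monom 1 (lee (z ! j - c ! j))))"
      by (simp add: pairing_def prod_smult prod_monom)
    also have "\<dots> = (\<Prod>j<q. \<Sum>b\<in>UNIV. smult (chi (b * ?u j)) (monom 1 (lee (z ! j - b))))"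
      by (rule sum_prod_lists)
    also have "\<dots> = smult (pairing z u) (gen (2 * q) (weight u))"
      by (simp only: sum_chi_lee prod_smult prod_gen pairing_def weight_def)
    finally show "(\<Sum>c | length c = q. smult (pairing c u) (?W c)) = smult (pairing z u) (gen (2 * q) (weight u))" .
  qed
  finally show ?thesis .
qed

section \<open>Grouping the dual words by weight\<close>

definition coef :: "4 list \<Rightarrow> nat \<Rightarrow> complex" where
  "coef z k = (\<Sum>u | u \<in> U \<and> weight u = k. pairing z u)"

lemma enumerator_weights:
  "smult (of_nat (4 * q ^ 2)) (enumerator z)
    = (\<Sum>k\<in>{0, q, 2 * q, q - a, q + a}. smult (coef z k) (gen (2 * q) k))"
proof -
  have "(\<Sum>u\<in>U. smult (pairing z u) (gen (2 * q) (weight u)))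
      = (\<Sum>k\<in>{0, q, 2 * q, q - a, q + a}. \<Sum>u | u \<in> U \<and> weight u = k. smult (pairing z u) (gen (2 * q) (weight u)))"
  proof (rule sum.group[symmetric])
    show "weight ` U \<subseteq> {0, q, 2 * q, q - a, q + a}"
      by (rule image_subsetI) (rule weight_cases)
  qed (simp_all add: finite_U)
  also have "\<dots> = (\<Sum>k\<in>{0, q, 2 * q, q - a, q + a}. smult (coef z k) (gen (2 * q) k))"
    by (intro sum.cong refl) (simp add: coef_def smult_sum)
  finally show ?thesis by (simp only: enumerator_eq)
qed

text \<open>The common parity of the distances from \<open>z\<close> to the codewords, see
  \<open>minus_one_power_dist4\<close>.\<close>

definition sgn_of :: "4 list \<Rightarrow> complex" where
  "sgn_of z = chi (2 * sum_list z)"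

lemma coef_0:
  assumes "length z = q"
  shows "coef z 0 = 1"
proof -
  have U: "(0, replicate m 0) \<in> U" by (simp add: U_def)
  have "{u. u \<in> U \<and> weight u = 0} = {(0, replicate m 0)}"
  proof (intro set_eqI iffI)
    fix u assume "u \<in> {u. u \<in> U \<and> weight u = 0}"
    then show "u \<in> {(0, replicate m 0)}" using weight_eq_0_iff[of u] by simp
  next
    fix u assume "u \<in> {(0 :: 4, replicate m (0 :: 4))}"
    then have "u = (0, replicate m 0)" by simp
    then show "u \<in> {u. u \<in> U \<and> weight u = 0}"
      using U weight_eq_0_iff[OF U] by (simp only: mem_Collect_eq)
  qed
  then have "coef z 0 = pairing z (0, replicate m 0)" by (simp add: coef_def)
  also have "\<dots> = 1" by (simp add: pairing_def lam_def)
  finally show ?thesis .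
qed

text \<open>Adding 2 to the constant \<open>e\<close> reflects the weights at \<open>q\<close> and
  multiplies each pairing by \<open>chi (2 * sum_list z)\<close>.\<close>

lemma coef_reflect:
  assumes "length z = q" "k \<le> 2 * q"
  shows "coef z (2 * q - k) = sgn_of z * coef z k"
proof -
  have shift: "pairing z (e + 2, l) = sgn_of z * pairing z (e, l)" for e l
    by (simp add: pairing_eq[OF assms(1)] sgn_of_def ring_distribs chi_add)
  let ?s = "\<lambda>(e, l). (e + 2 :: 4, l :: 4 list)"
  have four: "e + 2 + 2 = e" for e :: 4 by (simp add: add.assoc)
  have w: "weight (?s u) = 2 * q - weight u" for u by (cases u) (simp add: weight_shift)
  have "coef z (2 * q - k) = (\<Sum>u | u \<in> U \<and> weight u = k. pairing z (?s u))"
    unfolding coef_def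
  proof (rule sum.reindex_bij_witness[of _ ?s ?s])
    fix u assume u: "u \<in> {u. u \<in> U \<and> weight u = 2 * q - k}"
    show "?s (?s u) = u" by (cases u) (simp add: four)
    have "?s u \<in> U" using u by (cases u) (simp add: U_def)
    moreover have "weight (?s u) = k" using u assms(2) by (simp only: w) simp
    ultimately show "?s u \<in> {u. u \<in> U \<and> weight u = k}" by blast
    show "pairing z (?s (?s u)) = pairing z u" by (cases u) (simp add: four)
  next
    fix u assume u: "u \<in> {u. u \<in> U \<and> weight u = k}"
    show "?s (?s u) = u" by (cases u) (simp add: four)
    have "?s u \<in> U" using u by (cases u) (simp add: U_def)
    moreover have "weight (?s u) = 2 * q - k" using u by (simp only: w) simp
    ultimately show "?s u \<in> {u. u \<in> U \<and> weight u = 2 * q - k}" by blast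
  qed
  also have "\<dots> = sgn_of z * coef z k"
    unfolding coef_def sum_distrib_left by (intro sum.cong refl) (auto simp: shift)
  finally show ?thesis .
qed

text \<open>Reflection eliminates the weights \<open>2 * q\<close> and \<open>q + a\<close>; besides
  the sign of \<open>z\<close> only two unknowns remain.\<close>

lemma enumerator_expand:
  assumes "length z = q"
  shows "smult (of_nat (4 * q ^ 2)) (enumerator z)
    = gen (2 * q) 0 + smult (sgn_of z) (gen (2 * q) (2 * q)) + smult (coef z q) (gen (2 * q) q)
      + smult (coef z (q - a)) (gen (2 * q) (q - a) + smult (sgn_of z) (gen (2 * q) (q + a)))"
proof -
  have "coef z (2 * q - (q - a)) = sgn_of z * coef z (q - a)"
    by (rule coef_reflect[OF assms]) simp
  moreover have "2 * q - (q - a) = q + a" using a_less_q by linarith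
  ultimately have "coef z (q + a) = sgn_of z * coef z (q - a)" by (simp only:)
  moreover have "coef z (2 * q) = sgn_of z"
    using coef_reflect[OF assms, of 0] coef_0[OF assms] by simp
  moreover have "(\<Sum>k\<in>{0, q, 2 * q, q - a, q + a}. f k) = f 0 + f (2 * q) + f q + (f (q - a) + f (q + a))"
    for f :: "nat \<Rightarrow> complex poly"
  proof -
    \<comment> \<open>The sum runs over a set, so it has five terms only because the five weights
      are pairwise distinct.\<close>
    have "a \<noteq> 0" "q \<noteq> 0" "q \<noteq> a" "\<not> q \<le> a" "q + a \<noteq> 2 * q" "q - a \<noteq> 2 * q" "q - a \<noteq> q" "q - a \<noteq> q + a"
      using a_pos a_less_q by linarith+
    then show ?thesis by (simp add: ac_simps)
  qed
  ultimately show ?thesis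
    unfolding enumerator_weights by (simp add: coef_0[OF assms] smult_add_right mult.commute)
qed

text \<open>The weight \<open>q\<close> is fixed by the reflection. For odd \<open>z\<close> this
  forces \<open>coef z q = 0\<close>.\<close>

lemma coef_q_eq:
  assumes "length z = q"
  shows "coef z q = sgn_of z * coef z q"
  using coef_reflect[OF assms, of q] by simp

end

section \<open>Outer distribution\<close>

lemma coeffs_linear_power:
  fixes x :: complex
  shows "coeff ([:1, x:] ^ t) 0 = 1" "coeff ([:1, x:] ^ t) 1 = of_nat t * x"
    "coeff ([:1, x:] ^ t) 2 = of_nat t * (of_nat t - 1) / 2 * x ^ 2"
    "coeff ([:1, x:] ^ t) 3 = of_nat t * (of_nat t - 1) * (of_nat t - 2) / 6 * x ^ 3"
    "coeff ([:1, x:] ^ t) 4 = of_nat t * (of_nat t - 1) * (of_nat t - 2) * (of_nat t - 3) / 24 * x ^ 4"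
proof (induction t)
  case (Suc t)
  \<comment> \<open>Multiplication by the linear factor is Pascal's rule.\<close>
  have step: "0 < k \<Longrightarrow> coeff ([:1, x:] ^ Suc t) k = coeff ([:1, x:] ^ t) k + x * coeff ([:1, x:] ^ t) (k - 1)" for k
    by (cases k) simp_all
  have "coeff ([:1, x:] ^ Suc t) 1 = coeff ([:1, x:] ^ t) 1 + x * coeff ([:1, x:] ^ t) 0"
    "coeff ([:1, x:] ^ Suc t) 2 = coeff ([:1, x:] ^ t) 2 + x * coeff ([:1, x:] ^ t) 1"
    "coeff ([:1, x:] ^ Suc t) 3 = coeff ([:1, x:] ^ t) 3 + x * coeff ([:1, x:] ^ t) 2"
    "coeff ([:1, x:] ^ Suc t) 4 = coeff ([:1, x:] ^ t) 4 + x * coeff ([:1, x:] ^ t) 3"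
    using step[of 1] step[of 2] step[of 3] step[of 4] by (simp_all del: power_Suc)
  note steps = this[unfolded Suc]
  show "coeff ([:1, x:] ^ Suc t) 0 = 1" using Suc(1) by simp
  show "coeff ([:1, x:] ^ Suc t) 1 = of_nat (Suc t) * x"
    unfolding steps(1) by (simp add: algebra_simps)
  show "coeff ([:1, x:] ^ Suc t) 2 = of_nat (Suc t) * (of_nat (Suc t) - 1) / 2 * x ^ 2"
    unfolding steps(2) by (simp add: field_simps power2_eq_square)
  show "coeff ([:1, x:] ^ Suc t) 3 = of_nat (Suc t) * (of_nat (Suc t) - 1) * (of_nat (Suc t) - 2) / 6 * x ^ 3"
    unfolding steps(3) by (simp add: field_simps power2_eq_square power3_eq_cube)
  show "coeff ([:1, x:] ^ Suc t) 4 = of_nat (Suc t) * (of_nat (Suc t) - 1) * (of_nat (Suc t) - 2) * (of_nat (Suc t) - 3) / 24 * x ^ 4"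
    unfolding steps(4) by (simp add: field_simps power2_eq_square power3_eq_cube power4_eq_xxxx)
qed (simp_all add: numeral_eq_Suc)

lemma coeffs_quadratic_power:
  shows "coeff ([:1, 0, -1:] ^ r) 0 = (1 :: complex)" "coeff ([:1, 0, -1:] ^ r) 1 = (0 :: complex)"
    "coeff ([:1, 0, -1:] ^ r) 2 = - (of_nat r :: complex)" "coeff ([:1, 0, -1:] ^ r) 3 = (0 :: complex)"
    "coeff ([:1, 0, -1:] ^ r) 4 = (of_nat r * (of_nat r - 1) / 2 :: complex)"
proof (induction r)
  case (Suc r)
  let ?p = "[:1, 0, -1:] :: complex poly"
  have step: "1 < k \<Longrightarrow> coeff (?p ^ Suc r) k = coeff (?p ^ r) k - coeff (?p ^ r) (k - 2)" for k
    by (cases k; cases "k - 1") simp_all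
  have "coeff (?p ^ Suc r) 2 = coeff (?p ^ r) 2 - coeff (?p ^ r) 0"
    "coeff (?p ^ Suc r) 3 = coeff (?p ^ r) 3 - coeff (?p ^ r) 1"
    "coeff (?p ^ Suc r) 4 = coeff (?p ^ r) 4 - coeff (?p ^ r) 2"
    using step[of 2] step[of 3] step[of 4] by (simp_all del: power_Suc)
  note steps = this[unfolded Suc]
  show "coeff (?p ^ Suc r) 0 = 1" using Suc(1) by simp
  show "coeff (?p ^ Suc r) 1 = 0" using Suc(2) by simp
  show "coeff (?p ^ Suc r) 2 = - of_nat (Suc r)" unfolding steps(1) by simp
  show "coeff (?p ^ Suc r) 3 = 0" unfolding steps(2) by simp
  show "coeff (?p ^ Suc r) 4 = of_nat (Suc r) * (of_nat (Suc r) - 1) / 2"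
    unfolding steps(3) by (simp add: field_simps)
qed (simp_all add: numeral_eq_Suc)

text \<open>The identity (1 + X)(1 - X) = 1 - X^2 absorbs the common factors of \<open>gen\<close>,
  so that for weights near \<open>q\<close> few linear factors are left; the parameter
  \<open>x\<close> is 1 or -1.\<close>

definition sgen :: "complex \<Rightarrow> nat \<Rightarrow> nat \<Rightarrow> complex poly" where
  "sgen x r t = [:1, 0, -1:] ^ r * [:1, x:] ^ t"

lemma coeffs_sgen:
  "coeff (sgen x r t) 0 = 1" "coeff (sgen x r t) 1 = of_nat t * x"
  "coeff (sgen x r t) 2 = of_nat t * (of_nat t - 1) / 2 * x ^ 2 - of_nat r"
  "coeff (sgen x r t) 4 = of_nat t * (of_nat t - 1) * (of_nat t - 2) * (of_nat t - 3) / 24 * x ^ 4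
     - of_nat r * (of_nat t * (of_nat t - 1) / 2 * x ^ 2) + of_nat r * (of_nat r - 1) / 2"
proof -
  let ?c = "coeff ([:1, 0, -1:] ^ r)" and ?d = "coeff ([:1, x:] ^ t)"
  have s: "{..0} = {0 :: nat}" "{..1} = {0, 1 :: nat}" "{..2} = {0, 1, 2 :: nat}" "{..4} = {0, 1, 2, 3, 4 :: nat}"
    by auto
  have "coeff (sgen x r t) 0 = ?c 0 * ?d 0" "coeff (sgen x r t) 1 = ?c 0 * ?d 1 + ?c 1 * ?d 0"
    "coeff (sgen x r t) 2 = ?c 0 * ?d 2 + ?c 1 * ?d 1 + ?c 2 * ?d 0"
    "coeff (sgen x r t) 4 = ?c 0 * ?d 4 + ?c 1 * ?d 3 + ?c 2 * ?d 2 + ?c 3 * ?d 1 + ?c 4 * ?d 0"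
    unfolding sgen_def coeff_mult s by simp_all
  note eqs = this[unfolded coeffs_linear_power coeffs_quadratic_power]
  show "coeff (sgen x r t) 0 = 1" "coeff (sgen x r t) 1 = of_nat t * x"
    "coeff (sgen x r t) 2 = of_nat t * (of_nat t - 1) / 2 * x ^ 2 - of_nat r"
    "coeff (sgen x r t) 4 = of_nat t * (of_nat t - 1) * (of_nat t - 2) * (of_nat t - 3) / 24 * x ^ 4
       - of_nat r * (of_nat t * (of_nat t - 1) / 2 * x ^ 2) + of_nat r * (of_nat r - 1) / 2"
    unfolding eqs by simp_all
qed

lemma linear_power_mult: "[:1, 1:] ^ j * [:1, -1:] ^ j = ([:1, 0, -1:] :: complex poly) ^ j"
proof -
  have "[:1, 1:] * [:1, -1:] = ([:1, 0, -1:] :: complex poly)" by simp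
  then show ?thesis by (simp only: power_mult_distrib[symmetric])
qed

lemma gen_below:
  assumes "k \<le> q"
  shows "gen (2 * q) k = sgen 1 k (2 * (q - k))"
proof -
  have "2 * q - k = k + 2 * (q - k)" using assms by simp
  then have "gen (2 * q) k = [:1, 1:] ^ k * [:1, 1:] ^ (2 * (q - k)) * [:1, -1:] ^ k"
    unfolding gen_def by (simp only: power_add)
  also have "\<dots> = ([:1, 1:] ^ k * [:1, -1:] ^ k) * [:1, 1:] ^ (2 * (q - k))"
    by (simp only: mult_ac)
  finally show ?thesis by (simp only: linear_power_mult sgen_def)
qed

lemma gen_above:
  assumes "q \<le> k" "k \<le> 2 * q"
  shows "gen (2 * q) k = sgen (-1) (2 * q - k) (2 * (k - q))"
proof -
  have "k = (2 * q - k) + 2 * (k - q)" using assms by simp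
  then have "[:1, -1:] ^ k = [:1, -1:] ^ (2 * q - k) * ([:1, -1:] :: complex poly) ^ (2 * (k - q))"
    by (metis power_add)
  then have "gen (2 * q) k = ([:1, 1:] ^ (2 * q - k) * [:1, -1:] ^ (2 * q - k)) * [:1, -1:] ^ (2 * (k - q))"
    unfolding gen_def by (simp only: mult.assoc)
  then show ?thesis by (simp only: linear_power_mult sgen_def)
qed

context teichmueller
begin

section \<open>Equations for the numbers of codewords at given distances\<close>

definition dist4 :: "4 list \<Rightarrow> 4 list \<Rightarrow> nat" where
  "dist4 z c = (\<Sum>j<q. lee (z ! j - c ! j))"

definition dcount :: "4 list \<Rightarrow> nat \<Rightarrow> nat" where
  "dcount z k = card {c \<in> code. dist4 z c = k}"

lemma length_code: "c \<in> code \<Longrightarrow> length c = q"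
  using mem_code_iff by blast

lemma finite_code: "finite code"
  by (rule finite_subset[OF _ finite_lists_q]) (auto dest: length_code)

lemma coeff_enumerator: "coeff (enumerator z) k = of_nat (dcount z k)"
proof -
  have "coeff (enumerator z) k = (\<Sum>c\<in>code. if dist4 z c = k then 1 else 0)"
    by (simp add: enumerator_def coeff_sum dist4_def eq_commute)
  also have "\<dots> = of_nat (dcount z k)"
    using finite_code by (simp add: dcount_def flip: sum.inter_filter)
  finally show ?thesis .
qed

text \<open>The parity of the Lee weight is an additive character, and codewords have sum 0.\<close>

lemma minus_one_power_dist4:
  assumes "length z = q" "c \<in> code"
  shows "(-1) ^ dist4 z c = sgn_of z"
proof -
  have "(-1) ^ dist4 z c = chi (\<Sum>j<q. 2 * (z ! j - c ! j))"
    by (simp add: dist4_def power_sum minus_one_power_lee chi_sum)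
  also have "(\<Sum>j<q. 2 * (z ! j - c ! j)) = 2 * (sum_list z - sum_list c)"
    using assms length_code by (simp add: sum_list_sum_nth atLeast0LessThan sum_subtractf sum_distrib_left right_diff_distrib)
  also have "sum_list c = 0" using assms mem_code_iff by blast
  finally show ?thesis by (simp add: sgn_of_def)
qed

lemma sgn_of_cases: "sgn_of z = 1 \<or> sgn_of z = -1"
  by (simp add: sgn_of_def chi_two_eq)

lemma coeff_expand:
  assumes "length z = q"
  shows "4 * of_nat q ^ 2 * of_nat (dcount z k) = coeff (sgen 1 0 (2 * q)) k
    + sgn_of z * coeff (sgen (-1) 0 (2 * q)) k + coef z q * coeff (sgen 1 q 0) k
    + coef z (q - a) * (coeff (sgen 1 (q - a) (2 * a)) k + sgn_of z * coeff (sgen (-1) (q - a) (2 * a)) k)"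
proof -
  have g: "gen (2 * q) 0 = sgen 1 0 (2 * q)" "gen (2 * q) (2 * q) = sgen (-1) 0 (2 * q)"
    "gen (2 * q) q = sgen 1 q 0"
    using gen_below[of 0 q] gen_above[of q "2 * q"] gen_below[of q q] by simp_all
  have "2 * (q - (q - a)) = 2 * a" "2 * q - (q + a) = q - a" "2 * (q + a - q) = 2 * a"
    using a_less_q by linarith+
  then have g': "gen (2 * q) (q - a) = sgen 1 (q - a) (2 * a)" "gen (2 * q) (q + a) = sgen (-1) (q - a) (2 * a)"
    using gen_below[of "q - a" q] gen_above[of q "q + a"] a_less_q by simp_all
  have "4 * of_nat q ^ 2 * of_nat (dcount z k) = coeff (smult (of_nat (4 * q ^ 2)) (enumerator z)) k"
    by (simp add: coeff_enumerator)
  also have "\<dots> = coeff (sgen 1 0 (2 * q)) k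
    + sgn_of z * coeff (sgen (-1) 0 (2 * q)) k + coef z q * coeff (sgen 1 q 0) k
    + coef z (q - a) * (coeff (sgen 1 (q - a) (2 * a)) k + sgn_of z * coeff (sgen (-1) (q - a) (2 * a)) k)"
    unfolding enumerator_expand[OF assms] g g' by (simp only: coeff_add coeff_smult)
  finally show ?thesis .
qed

lemma of_nat_q: "(of_nat q :: complex) = 2 * of_nat a ^ 2"
  by (simp add: q_eq_a)

lemma of_nat_q_minus_a: "(of_nat (q - a) :: complex) = of_nat q - of_nat a"
  using a_less_q by (simp add: of_nat_diff)

text \<open>In degree 2 the term of \<^term>\<open>coef z (q - a)\<close> vanishes because \<open>q = 2 a\<^sup>2\<close>.\<close>

lemma even_relations:
  assumes "length z = q" "sgn_of z = 1"
  shows "4 * of_nat q ^ 2 * of_nat (dcount z 0) = 2 + coef z q + 2 * coef z (q - a)"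
    "4 * of_nat q ^ 2 * of_nat (dcount z 2) = of_nat q * (4 * of_nat q - 2) - of_nat q * coef z q"
    "4 * of_nat q ^ 2 * of_nat (dcount z 4) = 
      2 * of_nat q * (2 * of_nat q - 1) * (2 * of_nat q - 2) * (2 * of_nat q - 3) / 12
      + of_nat q * (of_nat q - 1) / 2 * coef z q
      + 2 * coef z (q - a) * (of_nat a * (2 * of_nat a - 1) * (2 * of_nat a - 2) * (2 * of_nat a - 3) / 12
         - (of_nat q - of_nat a) * (of_nat a * (2 * of_nat a - 1)) + (of_nat q - of_nat a) * (of_nat q - of_nat a - 1) / 2)"
proof -
  show "4 * of_nat q ^ 2 * of_nat (dcount z 0) = 2 + coef z q + 2 * coef z (q - a)"
    unfolding coeff_expand[OF assms(1)] assms(2) coeffs_sgen by simp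
  show "4 * of_nat q ^ 2 * of_nat (dcount z 2) = of_nat q * (4 * of_nat q - 2) - of_nat q * coef z q"
    unfolding coeff_expand[OF assms(1)] assms(2) coeffs_sgen of_nat_q_minus_a
    by (simp add: of_nat_q field_simps power2_eq_square)
  show "4 * of_nat q ^ 2 * of_nat (dcount z 4) = 
      2 * of_nat q * (2 * of_nat q - 1) * (2 * of_nat q - 2) * (2 * of_nat q - 3) / 12
      + of_nat q * (of_nat q - 1) / 2 * coef z q
      + 2 * coef z (q - a) * (of_nat a * (2 * of_nat a - 1) * (2 * of_nat a - 2) * (2 * of_nat a - 3) / 12
         - (of_nat q - of_nat a) * (of_nat a * (2 * of_nat a - 1)) + (of_nat q - of_nat a) * (of_nat q - of_nat a - 1) / 2)"
    unfolding coeff_expand[OF assms(1)] assms(2) coeffs_sgen of_nat_q_minus_a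
    by (simp add: field_simps)
qed

text \<open>In degree 1 the weight \<open>q\<close> drops out, since its transform is a polynomial
  in X^2, while for odd \<open>z\<close> the contributions of \<open>q - a\<close> and
  \<open>q + a\<close> are equal.\<close>

lemma odd_relation:
  assumes "length z = q" "sgn_of z = -1"
  shows "4 * of_nat q ^ 2 * of_nat (dcount z 1) = 4 * of_nat q + 4 * of_nat a * coef z (q - a)"
  unfolding coeff_expand[OF assms(1)] assms(2) coeffs_sgen by simp

text \<open>For even \<open>z\<close>, degree 2 determines \<open>coef z q\<close>, and then degree
  0 determines \<open>coef z (q - a)\<close>. For odd \<open>z\<close> the former is 0 and degree 1
  determines the latter.\<close>

lemma enumerator_cong:
  assumes "length z = q" "length z' = q" "sgn_of z = sgn_of z'"
    and "dcount z 0 = dcount z' 0" "dcount z 1 = dcount z' 1" "dcount z 2 = dcount z' 2"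
  shows "enumerator z = enumerator z'"
proof -
  have q0: "of_nat q \<noteq> (0 :: complex)" "of_nat a \<noteq> (0 :: complex)" using q_pos a_pos by auto
  have "coef z q = coef z' q \<and> coef z (q - a) = coef z' (q - a)"
  proof (cases "sgn_of z = 1")
    case True
    then have s: "sgn_of z' = 1" using assms by simp
    have "of_nat q * (4 * of_nat q - 2) - of_nat q * coef z q = of_nat q * (4 * of_nat q - 2) - of_nat q * coef z' q"
      by (simp only: even_relations(2)[OF assms(1) True, symmetric] even_relations(2)[OF assms(2) s, symmetric] assms(6))
    then have "of_nat q * coef z q = of_nat q * coef z' q" by (rule diff_left_imp_eq)
    then have *: "coef z q = coef z' q" using q0 by simp
    have "2 + coef z q + 2 * coef z (q - a) = 2 + coef z' q + 2 * coef z' (q - a)"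
      by (simp only: even_relations(1)[OF assms(1) True, symmetric] even_relations(1)[OF assms(2) s, symmetric] assms(4))
    then have "2 * coef z (q - a) = 2 * coef z' (q - a)" by (simp only: * add_left_cancel)
    with * show ?thesis by simp
  next
    case False
    then have s: "sgn_of z = -1" "sgn_of z' = -1" using sgn_of_cases assms by auto
    have "4 * of_nat q + 4 * of_nat a * coef z (q - a) = 4 * of_nat q + 4 * of_nat a * coef z' (q - a)"
      by (simp only: odd_relation[OF assms(1) s(1), symmetric] odd_relation[OF assms(2) s(2), symmetric] assms(5))
    then have "4 * of_nat a * coef z (q - a) = 4 * of_nat a * coef z' (q - a)" by (simp only: add_left_cancel)
    moreover have "coef z q = 0" "coef z' q = 0"
      using coef_q_eq[OF assms(1)] coef_q_eq[OF assms(2)] s by simp_all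
    ultimately show ?thesis using q0 by simp
  qed
  then have "smult (of_nat (4 * q ^ 2)) (enumerator z) = smult (of_nat (4 * q ^ 2)) (enumerator z')"
    by (simp only: enumerator_expand[OF assms(1)] enumerator_expand[OF assms(2)] assms(3))
  moreover have "of_nat (4 * q ^ 2) \<noteq> (0 :: complex)" using q0 by simp
  ultimately show ?thesis by (simp only: smult_cancel)
qed

section \<open>Minimum distance\<close>

lemma zero_in_code: "replicate q 0 \<in> code"
  by (simp add: mem_code_iff sum_list_replicate)

lemma dist4_zero: "length c = q \<Longrightarrow> dist4 (replicate q 0) c = 0 \<longleftrightarrow> c = replicate q 0"
proof -
  assume c: "length c = q"
  have neg: "lee (0 - x) = 0 \<longleftrightarrow> x = 0" for x
  proof -
    have "\<forall>x. lee (0 - x) = 0 \<longleftrightarrow> x = 0" by (simp add: all_4 lee_def)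
    then show ?thesis by (rule spec)
  qed
  have "dist4 (replicate q 0) c = (\<Sum>j<q. lee (0 - c ! j))"
    unfolding dist4_def by (intro sum.cong refl) simp
  then have "dist4 (replicate q 0) c = 0 \<longleftrightarrow> (\<forall>j<q. c ! j = 0)"
    using neg by (simp only: sum_eq_0_iff finite_lessThan lessThan_iff Ball_def)
  then show ?thesis using c by (auto simp: list_eq_iff_nth_eq)
qed

text \<open>All pairings with the zero word are 1, so its \<open>coef\<close> at \<open>q\<close>
  just counts dual words. That 0 is the only codeword at distance 0 then yields the other
  unknown.\<close>

lemma dcount_zero_word:
  "dcount (replicate q 0) 0 = 1" "dcount (replicate q 0) 2 = 0" "dcount (replicate q 0) 4 = 0"
proof -
  let ?z = "replicate q (0 :: 4)"
  have len: "length ?z = q" by simp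
  have s: "sgn_of ?z = 1" by (simp add: sgn_of_def sum_list_replicate)
  have "{c \<in> code. dist4 ?z c = 0} = {?z}"
    using zero_in_code dist4_zero length_code by auto
  then show d0: "dcount ?z 0 = 1" by (simp add: dcount_def)
  have "coef ?z q = (\<Sum>u\<in>{u \<in> U. weight u = q}. 1)"
    unfolding coef_def by (intro sum.cong refl) (simp add: pairing_def)
  then have "coef ?z q = of_nat (4 * q - 2)" by (simp add: card_weight_q)
  then have A: "coef ?z q = 4 * of_nat q - 2" using q_pos by (simp add: of_nat_diff)
  have B: "coef ?z (q - a) = 2 * of_nat q ^ 2 - 2 * of_nat q"
  proof -
    have "4 * of_nat q ^ 2 = 4 * of_nat q + 2 * coef ?z (q - a)"
      using even_relations(1)[OF len s] by (simp add: A d0)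
    then show ?thesis by algebra
  qed
  have q0: "(4 :: complex) * of_nat q ^ 2 \<noteq> 0" using q_pos by simp
  have "4 * of_nat q ^ 2 * of_nat (dcount ?z 2) = (0 :: complex)"
    using even_relations(2)[OF len s] by (simp add: A)
  then show "dcount ?z 2 = 0" using q0 by simp
  \<comment> \<open>By \<open>q = 2 a^2\<close> the right-hand side in degree 4 is a polynomial in
    \<open>a\<close>, and it vanishes identically.\<close>
  note even_relations(3)[OF len s]
  also have "2 * of_nat q * (2 * of_nat q - 1) * (2 * of_nat q - 2) * (2 * of_nat q - 3) / 12
      + of_nat q * (of_nat q - 1) / 2 * coef ?z q
      + 2 * coef ?z (q - a) * (of_nat a * (2 * of_nat a - 1) * (2 * of_nat a - 2) * (2 * of_nat a - 3) / 12
         - (of_nat q - of_nat a) * (of_nat a * (2 * of_nat a - 1)) + (of_nat q - of_nat a) * (of_nat q - of_nat a - 1) / 2)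
      = 0"
    unfolding A B of_nat_q by (simp add: field_simps power2_eq_square)
  finally show "dcount ?z 4 = 0" using q0 by simp
qed

text \<open>By linearity the first word may be taken to be 0. The counts for the zero word exclude
  the distances 2 and 4, and parity excludes the odd ones.\<close>

lemma dist4_code:
  assumes "c \<in> code" "c' \<in> code" "c \<noteq> c'"
  shows "dist4 c c' \<ge> 6"
proof -
  let ?z = "replicate q (0 :: 4)"
  define d where "d = map2 (-) c' c"
  have len: "length c = q" "length c' = q" "length d = q"
    using assms length_code by (auto simp: d_def)
  have nth: "d ! j = c' ! j - c ! j" if "j < q" for j using that len by (simp add: d_def)
  have "sum_list d = sum_list c' - sum_list c"
    using len nth by (simp add: sum_list_sum_nth atLeast0LessThan sum_subtractf)
  moreover have "(\<Sum>j<q. smult (d ! j) (tau j)) = (\<Sum>j<q. smult (c' ! j) (tau j)) - (\<Sum>j<q. smult (c ! j) (tau j))"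
    using nth by (simp add: sum_subtractf[symmetric] smult_diff_left)
  ultimately have d: "d \<in> code" using assms len by (auto simp: mem_code_iff)
  have dist: "dist4 c c' = dist4 ?z d"
    unfolding dist4_def by (intro sum.cong refl) (simp add: nth)
  have none: "dist4 ?z d \<noteq> k" if "dcount ?z k = 0" for k
    using that d finite_code by (auto simp: dcount_def)
  have "dist4 ?z d \<noteq> 0"
  proof
    assume "dist4 ?z d = 0"
    then have "d = ?z" using dist4_zero len by blast
    then have "c' ! j = c ! j" if "j < q" for j using nth[OF that] that by simp
    then have "c = c'" using len by (intro nth_equalityI) auto
    then show False using assms by simp
  qed
  moreover have "dist4 ?z d \<noteq> 2" "dist4 ?z d \<noteq> 4" using none dcount_zero_word by blast+
  moreover have "even (dist4 ?z d)"
  proof (rule ccontr)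
    assume "odd (dist4 ?z d)"
    then have "sgn_of ?z = -1" using minus_one_power_dist4[of ?z d] d by simp
    then show False by (simp add: sgn_of_def sum_list_replicate)
  qed
  ultimately have "\<not> dist4 ?z d < 6" by presburger
  then show ?thesis by (simp add: dist)
qed

section \<open>The binary code\<close>

abbreviation bcode :: "bit list set" where
  "bcode \<equiv> gray ` code"

lemma hamming_dist4: "length z = q \<Longrightarrow> c \<in> code \<Longrightarrow> hamming_dist (gray z) (gray c) = dist4 z c"
  using hamming_dist_gray length_code by (simp add: dist4_def)

lemma bcode_words: "bcode \<subseteq> words (2 * q)"
  using length_code by (auto simp: words_def gray_def)

lemma outer_distribution_gray:
  assumes "length z = q"
  shows "outer_distribution bcode (gray z) k = dcount z k"
proof -
  have "{y \<in> bcode. hamming_dist (gray z) y = k} = gray ` {c \<in> code. dist4 z c = k}"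
    using hamming_dist4[OF assms] by auto
  moreover have "inj_on gray {c \<in> code. dist4 z c = k}"
    using inj_gray length_code by (intro inj_onI) auto
  ultimately show ?thesis by (simp add: outer_distribution_def dcount_def card_image)
qed

lemma dist_to_attained:
  assumes "length z = q"
  obtains c where "c \<in> code" "dist4 z c = dist_to bcode (gray z)"
proof -
  have "dist_to bcode (gray z) \<in> hamming_dist (gray z) ` bcode"
    using finite_code zero_in_code by (intro Min_in) auto
  then show ?thesis using that hamming_dist4[OF assms] by auto
qed

lemma dist_to_le: "length z = q \<Longrightarrow> c \<in> code \<Longrightarrow> dist_to bcode (gray z) \<le> dist4 z c"
  using finite_code hamming_dist4 by (metis Min_le finite_imageI image_eqI)

lemma sgn_of_dist:
  assumes "length z = q"
  shows "sgn_of z = (-1) ^ dist_to bcode (gray z)"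
  using dist_to_attained[OF assms] minus_one_power_dist4[OF assms] by metis

text \<open>Two codewords within distance 2 of \<open>z\<close> would be at distance at most 4 from
  each other. So there is at most one, and it is the nearest.\<close>

lemma dcount_small:
  assumes z: "length z = q" and k: "k \<le> 2"
  shows "dcount z k = (if dist_to bcode (gray z) = k then 1 else 0)"
proof -
  have unique: "c = c'" if "c \<in> code" "c' \<in> code" "dist4 z c \<le> 2" "dist4 z c' \<le> 2" for c c'
  proof (rule ccontr)
    assume "c \<noteq> c'"
    then have "6 \<le> hamming_dist (gray c) (gray c')"
      using that dist4_code hamming_dist4 length_code by metis
    also have "\<dots> \<le> hamming_dist (gray c) (gray z) + hamming_dist (gray z) (gray c')"
      using that z length_code by (intro hamming_dist_triangle) (auto simp: gray_def)
    also have "hamming_dist (gray c) (gray z) = hamming_dist (gray z) (gray c)"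
      using that z length_code by (intro hamming_dist_commute) (auto simp: gray_def)
    finally show False using that z hamming_dist4 by simp
  qed
  obtain c where c: "c \<in> code" "dist4 z c = dist_to bcode (gray z)"
    using dist_to_attained[OF z] by blast
  show ?thesis
  proof (cases "dist_to bcode (gray z) = k")
    case True
    then have "{c' \<in> code. dist4 z c' = k} = {c}" using unique c k by auto
    then show ?thesis using True by (simp add: dcount_def)
  next
    case False
    have "{c' \<in> code. dist4 z c' = k} = {}"
    proof (rule ccontr)
      assume "\<not> ?thesis"
      then obtain c' where c': "c' \<in> code" "dist4 z c' = k" by blast
      then have "dist4 z c \<le> 2" using dist_to_le[OF z c'(1)] c k by simp
      then have "c = c'" using unique c c' k by simp
      then show False using c c' False by simp
    qed
    then have "dcount z k = 0" unfolding dcount_def by (simp only: card.empty)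
    then show ?thesis using False by simp
  qed
qed

text \<open>The distance to the code gives the parity and the counts up to distance 2; these give
  the enumerator, whose coefficients form the row.\<close>

lemma completely_regular_bcode: "completely_regular (2 * q) bcode"
proof (rule completely_regularI[OF bcode_words])
  show "bcode \<noteq> {}" using zero_in_code by blast
  fix x y assume "x \<in> words (2 * q)" "y \<in> words (2 * q)" and eq: "dist_to bcode x = dist_to bcode y"
  then have lengths: "length x = 2 * q" "length y = 2 * q" by (simp_all add: words_def)
  obtain z where z: "length z = q" "gray z = x" using gray_surj[OF lengths(1)] by blast
  obtain z' where z': "length z' = q" "gray z' = y" using gray_surj[OF lengths(2)] by blast
  have same: "dist_to bcode (gray z) = dist_to bcode (gray z')" by (simp only: eq z(2) z'(2))
  have small: "dcount z k = dcount z' k" if "k \<le> 2" for k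
    unfolding dcount_small[OF z(1) that] dcount_small[OF z'(1) that] same ..
  have "sgn_of z = sgn_of z'"
    unfolding sgn_of_dist[OF z(1)] sgn_of_dist[OF z'(1)] same ..
  then have "enumerator z = enumerator z'"
    using z z' by (intro enumerator_cong small) simp_all
  then have "(of_nat (dcount z k) :: complex) = of_nat (dcount z' k)" for k
    by (simp only: coeff_enumerator[symmetric])
  then have "dcount z k = dcount z' k" for k by (simp only: of_nat_eq_iff)
  then have "outer_distribution bcode x k = outer_distribution bcode y k" for k
    using outer_distribution_gray[OF z(1)] outer_distribution_gray[OF z'(1)] z z' by simp
  then have "outer_distribution bcode x = outer_distribution bcode y" by (rule ext)
  then show "outer_row (2 * q) bcode x = outer_row (2 * q) bcode y"
    by (simp only: outer_row_def)
qed

end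

theorem theorem21:
  fixes m :: nat and h2 :: "bit poly" and h :: "4 poly"
  assumes "m \<ge> 3" and "odd m"
    and "primitive_irreducible h2" and "degree h2 = m"
    and "is_lift (2 ^ m - 1) h2 h"
  shows "completely_regular (2 ^ (m + 1)) (gray ` preparata_Z4 (2 ^ m - 1) h)"
proof -
  interpret teichmueller m h2 h by unfold_locales (fact assms)+
  show ?thesis using completely_regular_bcode by (simp add: q_def n_def)
qed

end
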